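(* Let $E$ be a $k$-dimensional linear subspace of $\mathbb{R}^n$ ($1\le k\le n$). Then for $0<p<2$ and every $0<\alpha<k$ and $0<\beta\le p$, $$\mathbb{E}\|G\|_{E\cap B_p^n}^{-\alpha}\le\mathbb{E}\|G\|_{B_p^k}^{-\alpha}\quad\text{and}\quad\mathbb{E}\|G\|_{E\cap B_p^n}^{\beta}\ge\mathbb{E}\|G\|_{B_p^k}^{\beta}.$$ If $2<p<\infty$, then for every $0<\alpha<k$ and $0<\beta\le p$, $$\mathbb{E}\|G\|_{E\cap B_p^n}^{-\alpha}\ge\mathbb{E}\|G\|_{B_p^k}^{-\alpha}\quad\text{and}\quad\mathbb{E}\|G\|_{E\cap B_p^n}^{\beta}\le\mathbb{E}\|G\|_{B_p^k}^{\beta}.$$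
   Context: For $0<p<\infty$, $\|x\|_p=(\sum_i|x_i|^p)^{1/p}$. In expressions with $\|G\|_{E\cap B_p^n}$, $G$ is a standard Gaussian vector on the subspace $E$ and $\|G\|_{E\cap B_p^n}=\|G\|_p$ (the $\ell_p^n$ quasi-norm of $G\in E\subset\mathbb{R}^n$); in expressions with $\|G\|_{B_p^k}$, $G$ is a standard Gaussian vector in $\mathbb{R}^k$ and $\|G\|_{B_p^k}=\|G\|_p$ (the $\ell_p^k$ quasi-norm). *)

theory Defs
  imports "HOL-Probability.Probability"
begin

definition lp_norm :: "real \<Rightarrow> real ^ 'n \<Rightarrow> real" where
  "lp_norm p x = (\<Sum>i\<in>UNIV. \<bar>x $ i\<bar> powr p) powr (1 / p)"

definition orthonormal_basis_of :: "'a::euclidean_space set \<Rightarrow> 'a set \<Rightarrow> bool" where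
  "orthonormal_basis_of E B \<longleftrightarrow>
     pairwise orthogonal B \<and> (\<forall>b\<in>B. norm b = 1) \<and> span B = E"

text \<open>
  A random vector is standard Gaussian on a linear subspace if it lies in the subspace
  almost surely and its coordinates in an orthonormal basis of the subspace are independent
  standard normal variables. By rotation invariance it is immaterial whether this is
  required for some or for every orthonormal basis.
\<close>

definition std_gaussian_on ::
    "'a::euclidean_space set \<Rightarrow> 'w measure \<Rightarrow> ('w \<Rightarrow> 'a) \<Rightarrow> bool" where
  "std_gaussian_on E M G \<longleftrightarrow>
     prob_space M \<and> G \<in> borel_measurable M \<and> (AE w in M. G w \<in> E) \<and>
     (\<exists>B. orthonormal_basis_of E B \<and>
          prob_space.indep_vars M (\<lambda>_. borel) (\<lambda>b w. G w \<bullet> b) B \<and>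
          (\<forall>b\<in>B. distributed M lborel (\<lambda>w. G w \<bullet> b) std_normal_density))"

text \<open>
  The moment \<open>E \<parallel>G\<parallel>\<^sub>p\<^sup>r\<close>, as an element of \<open>[0, \<infinity>]\<close>, so that no integrability is presupposed.
  For negative \<open>r\<close> the convention \<open>0 powr r = 0\<close> is harmless for a standard Gaussian vector
  on a nonzero subspace, since such a vector vanishes with probability zero.
\<close>

definition lp_moment :: "real \<Rightarrow> 'w measure \<Rightarrow> ('w \<Rightarrow> real ^ 'n) \<Rightarrow> real \<Rightarrow> ennreal" where
  "lp_moment p M G r = (\<integral>\<^sup>+ w. ennreal (lp_norm p (G w) powr r) \<partial>M)"

end

theory Submission
  imports Defs
begin

text \<open>
  In an orthonormal basis of \<open>E\<close> the coordinates of \<open>G\<close> become \<open>G\<^sub>i = Y \<bullet> v\<^sub>i\<close> with \<open>Y\<close> standard Gaussian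
  in \<open>k\<close> dimensions and \<open>\<Sum>\<^sub>i (y \<bullet> v\<^sub>i)\<^sup>2 = |y|\<^sup>2\<close>. Hence the Laplace transform of \<open>\<parallel>G\<parallel>\<^sub>p\<^sup>p\<close> at \<open>\<tau>\<close> is,
  up to a constant, \<open>\<integral> \<Prod>\<^sub>i f(y \<bullet> v\<^sub>i) dy\<close> with \<open>f(t) = exp(-\<tau>|t|\<^sup>p - t\<^sup>2/2)\<close>. Let \<open>g\<close> be the centred Gaussian
  function with \<open>g(0) = f(0)\<close> and the same integral as \<open>f\<close>. On the positive half line \<open>f - g\<close> changes sign
  once, from plus to minus if \<open>p > 2\<close> and from minus to plus if \<open>p < 2\<close>. Replacing the factors \<open>f\<close> by \<open>g\<close>
  one at a time therefore changes the integral in a fixed direction, because the other factors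
  integrate over the slices \<open>{y \<bullet> v\<^sub>j = t}\<close> to an even function of \<open>t\<close> decreasing in \<open>|t|\<close>
  (Anderson's theorem, from the one-dimensional Prekopa-Leindler inequality). The final value
  \<open>\<integral> \<Prod>\<^sub>i g(y \<bullet> v\<^sub>i) dy\<close> depends only on \<open>|y|\<close>, and no step changes anything when the \<open>v\<^sub>i\<close> are orthonormal,
  which is the case of \<open>H\<close>. Both kinds of moments are positive mixtures: negative powers of the Laplace
  transform, positive powers \<open>s < 1\<close> of its complement, and \<open>s = 1\<close> is the derivative at \<open>0\<close>.
\<close>

section \<open>The Prekopa-Leindler inequality on the line\<close>

lemma level_emeasure:
  fixes r :: ennreal
  assumes "0 < A"
  shows "ennreal A * emeasure lborel {u::real. 0 \<le> u \<and> ennreal (A * u) < r} = r"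
proof (cases r)
  case (real s)
  have "{u::real. 0 \<le> u \<and> ennreal (A * u) < r} = {0..<s / A}"
    using assms real by (auto simp: ennreal_less_iff field_simps)
  then show ?thesis
    using assms real by (simp add: ennreal_mult[symmetric])
next
  case top
  have "{u::real. 0 \<le> u \<and> ennreal (A * u) < r} = {0..}"
    using top by auto
  moreover have "emeasure lborel {0::real..} = \<infinity>"
  proof (cases "emeasure lborel {0::real..}")
    case (real s)
    have "ennreal (s + 1) \<le> ennreal s"
      using emeasure_mono[of "{0..s + 1}" "{0..}" lborel] real by (auto simp del: ennreal_plus)
    then show ?thesis using real by (simp del: ennreal_plus)
  qed simp
  ultimately show ?thesis
    using assms top by (simp add: ennreal_mult_top)
qed

text \<open>By \<open>level_emeasure\<close>, \<open>F x\<close> is \<open>A\<close> times the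
  length of its set of levels \<open>u\<close>; exchanging the two integrals gives the formula. The
  free scale \<open>A\<close> makes it possible to cut two functions at proportional levels
  \<open>A * u\<close> and \<open>B * u\<close> with the same parameter \<open>u\<close>.\<close>

lemma layer_cake:
  fixes F :: "'a \<Rightarrow> ennreal"
  assumes "sigma_finite_measure M" "F \<in> borel_measurable M" "0 < A"
  shows "(\<integral>\<^sup>+x. F x \<partial>M) =
    ennreal A * (\<integral>\<^sup>+u. emeasure M {x\<in>space M. ennreal (A * u) < F x} * indicator {0..} u \<partial>lborel)"
proof -
  interpret sigma_finite_measure M by fact
  interpret pair_sigma_finite M lborel ..
  note [measurable] = assms(2)
  have "(\<integral>\<^sup>+x. F x \<partial>M) = (\<integral>\<^sup>+x. ennreal A * (\<integral>\<^sup>+u. indicator {u. 0 \<le> u \<and> ennreal (A * u) < F x} u \<partial>lborel) \<partial>M)"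
    by (simp add: level_emeasure assms)
  also have "\<dots> = ennreal A * (\<integral>\<^sup>+x. \<integral>\<^sup>+u. indicator {u. 0 \<le> u \<and> ennreal (A * u) < F x} u \<partial>lborel \<partial>M)"
    by (rule nn_integral_cmult) measurable
  also have "(\<integral>\<^sup>+x. \<integral>\<^sup>+u. indicator {u. 0 \<le> u \<and> ennreal (A * u) < F x} u \<partial>lborel \<partial>M) =
     (\<integral>\<^sup>+u. \<integral>\<^sup>+x. indicator {u. 0 \<le> u \<and> ennreal (A * u) < F x} u \<partial>M \<partial>lborel)"
    by (rule Fubini'[symmetric]) measurable
  also have "\<dots> = (\<integral>\<^sup>+u. emeasure M {x\<in>space M. ennreal (A * u) < F x} * indicator {0..} u \<partial>lborel)"
  proof (rule nn_integral_cong)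
    fix u :: real
    have "(\<integral>\<^sup>+x. indicator {u. 0 \<le> u \<and> ennreal (A * u) < F x} u \<partial>M) =
      (\<integral>\<^sup>+x. indicator {x\<in>space M. ennreal (A * u) < F x} x * indicator {0..} u \<partial>M)"
      by (rule nn_integral_cong) (auto split: split_indicator)
    also have "\<dots> = emeasure M {x\<in>space M. ennreal (A * u) < F x} * indicator {0..} u"
      by (subst nn_integral_multc) auto
    finally show "(\<integral>\<^sup>+x. indicator {u. 0 \<le> u \<and> ennreal (A * u) < F x} u \<partial>M) = \<dots>" .
  qed
  finally show ?thesis .
qed

section \<open>Brunn-Minkowski for intervals and its functional form\<close>

lemma emeasure_lborel_le_diameter:
  fixes S :: "real set"
  assumes "S \<noteq> {}" and D: "\<And>p q. p \<in> S \<Longrightarrow> q \<in> S \<Longrightarrow> q - p \<le> D"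
  shows "emeasure lborel S \<le> ennreal D"
proof -
  obtain p0 where p0: "p0 \<in> S" using assms by auto
  have bd: "bdd_above S" "bdd_below S"
    using D[OF p0] D[OF _ p0] by (auto intro!: bdd_aboveI[of _ "p0 + D"] bdd_belowI[of _ "p0 - D"] simp: algebra_simps)
  have S: "S \<subseteq> {Inf S..Sup S}"
    using bd by (auto intro: cInf_lower cSup_upper)
  have "Sup S \<le> p + D" if "p \<in> S" for p
    using \<open>S \<noteq> {}\<close> D[OF that] by (intro cSup_least) (auto simp: algebra_simps)
  then have "Sup S - D \<le> Inf S"
    using \<open>S \<noteq> {}\<close> by (intro cInf_greatest) (auto simp: algebra_simps)
  moreover have "Inf S \<le> Sup S"
    using S p0 by auto
  ultimately show ?thesis
    using emeasure_mono[OF S, of lborel] by (auto intro: order_trans simp: ennreal_leI)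
qed

text \<open>Segments \<open>[p, q]\<close> in \<open>S\<close> and \<open>[p', q']\<close> in
  \<open>T\<close> combine to a segment inside \<open>U\<close> of length
  \<open>(1 - l) * (q - p) + l * (q' - p')\<close>, which is therefore at most the measure
  \<open>c\<close> of \<open>U\<close>. Since \<open>S\<close> and \<open>T\<close> are intervals,
  exhausting first one and then the other by segments gives the claim.\<close>

lemma interval_Brunn_Minkowski:
  fixes S T U :: "real set"
  assumes l: "0 < l" "l < 1" and ne: "S \<noteq> {}" "T \<noteq> {}" and cv: "convex S" "convex T"
    and U: "U \<in> sets lborel" and sub: "\<And>x y. x \<in> S \<Longrightarrow> y \<in> T \<Longrightarrow> (1 - l) * x + l * y \<in> U"
  shows "ennreal (1 - l) * emeasure lborel S + ennreal l * emeasure lborel T \<le> emeasure lborel U"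
proof (cases "emeasure lborel U")
  case (real c)
  have seg: "(1 - l) * (q - p) + l * (q' - p') \<le> c"
    if "p \<in> S" "q \<in> S" "p' \<in> T" "q' \<in> T" "p \<le> q" "p' \<le> q'" for p q p' q'
  proof -
    let ?a = "(1 - l) * p + l * p'" and ?b = "(1 - l) * q + l * q'"
    have le: "?a \<le> ?b" using l that by (intro add_mono mult_left_mono) auto
    have "{?a..?b} \<subseteq> U"
    proof
      fix z assume z: "z \<in> {?a..?b}"
      then have "z \<in> closed_segment ?a ?b" using le by (simp add: closed_segment_eq_real_ivl)
      then obtain t where t: "0 \<le> t" "t \<le> 1" and z: "z = (1 - t) * ?a + t * ?b"
        by (auto simp: closed_segment_def)
      have "(1 - t) *\<^sub>R p + t *\<^sub>R q \<in> S" "(1 - t) *\<^sub>R p' + t *\<^sub>R q' \<in> T"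
        using convexD[OF cv(1), of p q "1 - t" t] convexD[OF cv(2), of p' q' "1 - t" t] that t by auto
      from sub[OF this] show "z \<in> U"
        unfolding z by (simp add: algebra_simps)
    qed
    from emeasure_mono[OF this, of lborel] U have "ennreal (?b - ?a) \<le> ennreal c"
      using le real by simp
    then show ?thesis
      using \<open>0 \<le> c\<close> by (simp add: algebra_simps)
  qed
  have seg: "(1 - l) * (q - p) + l * (q' - p') \<le> c"
    if "p \<in> S" "q \<in> S" "p' \<in> T" "q' \<in> T" for p q p' q'
  proof -
    have "(1 - l) * (q - p) \<le> (1 - l) * (max p q - min p q)"
      "l * (q' - p') \<le> l * (max p' q' - min p' q')"
      using l by (auto intro!: mult_left_mono)
    moreover have "(1 - l) * (max p q - min p q) + l * (max p' q' - min p' q') \<le> c"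
      by (rule seg) (use that in \<open>auto simp: max_def min_def\<close>)
    ultimately show ?thesis by linarith
  qed
  \<comment> \<open>For a fixed segment in \<open>T\<close>, the bound on \<open>q - p\<close> holds
    for all pairs in \<open>S\<close>, hence bounds the diameter of \<open>S\<close>. Below, the
    resulting measure \<open>s\<close> of \<open>S\<close> is held fixed and the diameter of
    \<open>T\<close> is bounded in the same way.\<close>
  have S: "emeasure lborel S \<le> ennreal ((c - l * (q' - p')) / (1 - l))" if "p' \<in> T" "q' \<in> T" for p' q'
    using seg[OF _ _ that] l by (intro emeasure_lborel_le_diameter ne) (auto simp: field_simps)
  obtain t where t: "t \<in> T" using ne by auto
  obtain s where s: "emeasure lborel S = ennreal s" "0 \<le> s"
    using S[OF t t] by (cases "emeasure lborel S") (auto simp: top_unique)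
  have "l * (q' - p') \<le> c - (1 - l) * s" if "p' \<in> T" "q' \<in> T" for p' q'
  proof -
    obtain x where x: "x \<in> S" using ne by auto
    have "0 \<le> c - l * (q' - p')" using seg[OF x x that] by simp
    then have "s \<le> (c - l * (q' - p')) / (1 - l)"
      using S[OF that] s l by (simp add: ennreal_le_iff)
    then show ?thesis using l by (simp add: field_simps)
  qed
  then have T: "emeasure lborel T \<le> ennreal ((c - (1 - l) * s) / l)"
    using l by (intro emeasure_lborel_le_diameter ne) (auto simp: field_simps)
  then obtain r where r: "emeasure lborel T = ennreal r" "0 \<le> r"
    by (cases "emeasure lborel T") (auto simp: top_unique)
  \<comment> \<open>\<open>ennreal\<close> sends negative reals to 0, so the bound on
    \<open>r\<close> can only be read off as a real inequality once its right-hand side is known to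
    be nonnegative.\<close>
  have "0 \<le> c - (1 - l) * s"
    using \<open>\<And>q' p'. _ \<Longrightarrow> _ \<Longrightarrow> l * (q' - p') \<le> c - (1 - l) * s\<close>[OF t t] by simp
  then have "r \<le> (c - (1 - l) * s) / l"
    using T r l by (simp add: ennreal_le_iff)
  then have "(1 - l) * s + l * r \<le> c"
    using l by (simp add: field_simps)
  then show ?thesis
    using r s l real by (simp add: ennreal_mult[symmetric] ennreal_plus[symmetric] ennreal_leI del: ennreal_plus)
qed auto

text \<open>Both functions are normalised by their suprema \<open>A\<close> and \<open>B\<close>.
  For \<open>0 \<le> u < 1\<close> the superlevel sets of \<open>f\<close> at \<open>A * u\<close>
  and of \<open>g\<close> at \<open>B * u\<close> are nonempty, and quasi-concavity makes them
  intervals; their convex combinations lie in a superlevel set of \<open>h\<close>. Interval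
  Brunn-Minkowski, integrated over \<open>u\<close>, gives an additive inequality, and weighted
  AM-GM turns it into the multiplicative one.\<close>

lemma Prekopa_Leindler_real_bounded:
  fixes f g h :: "real \<Rightarrow> ennreal"
  assumes l: "0 < l" "l < 1"
    and [measurable]: "f \<in> borel_measurable borel" "g \<in> borel_measurable borel" "h \<in> borel_measurable borel"
    and qf: "\<And>x y z. x \<le> z \<Longrightarrow> z \<le> y \<Longrightarrow> min (f x) (f y) \<le> f z"
    and qg: "\<And>x y z. x \<le> z \<Longrightarrow> z \<le> y \<Longrightarrow> min (g x) (g y) \<le> g z"
    and h: "\<And>x y a b. 0 \<le> a \<Longrightarrow> 0 \<le> b \<Longrightarrow> ennreal a \<le> f x \<Longrightarrow> ennreal b \<le> g y \<Longrightarrow>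
       ennreal (a powr (1 - l) * b powr l) \<le> h ((1 - l) * x + l * y)"
    and bdd: "\<And>x. f x \<le> ennreal N" "\<And>x. g x \<le> ennreal N"
    and ab: "0 < a" "0 < b" "ennreal a \<le> (\<integral>\<^sup>+x. f x \<partial>lborel)" "ennreal b \<le> (\<integral>\<^sup>+x. g x \<partial>lborel)"
  shows "ennreal (a powr (1 - l) * b powr l) \<le> (\<integral>\<^sup>+x. h x \<partial>lborel)"
proof -
  have sup: "\<exists>A>0. (SUP x. k x) = ennreal A"
    if "\<And>x. k x \<le> ennreal N" "0 < e" "ennreal e \<le> (\<integral>\<^sup>+x. k x \<partial>lborel)" for k :: "real \<Rightarrow> ennreal" and e
  proof -
    have "(SUP x. k x) \<le> ennreal N" using that by (auto intro: SUP_least)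
    then obtain A where A: "(SUP x. k x) = ennreal A" "0 \<le> A"
      by (cases "SUP x. k x") (auto simp: top_unique)
    have "A \<noteq> 0"
    proof
      assume "A = 0"
      then have "k x = 0" for x
        using A SUP_upper[of x UNIV k] by simp
      then show False using that by (simp add: ennreal_le_iff2)
    qed
    then show ?thesis using A by (intro exI[of _ A]) auto
  qed
  obtain A where A: "0 < A" "(SUP x. f x) = ennreal A" using sup[of f a] bdd ab by auto
  obtain B where B: "0 < B" "(SUP x. g x) = ennreal B" using sup[of g b] bdd ab by auto
  \<comment> \<open>The scale for \<open>h\<close>: levels \<open>A * u\<close> of \<open>f\<close>
    and \<open>B * u\<close> of \<open>g\<close> have weighted geometric mean
    \<open>c * u\<close>.\<close>
  define c where "c = A powr (1 - l) * B powr l"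
  have c: "0 < c" using A B by (simp add: c_def)
  have ce: "ennreal (c * u) = ennreal ((A * u) powr (1 - l) * (B * u) powr l)" if "0 \<le> u" for u
  proof -
    have "u powr (1 - l) * u powr l = u" using that l by (simp flip: powr_add)
    then show ?thesis
      using that A B by (simp add: powr_mult c_def mult_ac)
  qed
  have level: "ennreal (1 - l) * emeasure lborel {x. ennreal (A * u) < f x} +
     ennreal l * emeasure lborel {x. ennreal (B * u) < g x} \<le> emeasure lborel {x. ennreal (c * u) < h x}"
    if u: "0 \<le> u" "u < 1" for u
  proof (rule interval_Brunn_Minkowski[OF l])
    have "ennreal (A * u) < (SUP x. f x)" "ennreal (B * u) < (SUP x. g x)"
      using A B u by (auto simp: ennreal_less_iff)
    then show "{x. ennreal (A * u) < f x} \<noteq> {}" "{x. ennreal (B * u) < g x} \<noteq> {}"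
      by (auto simp: less_SUP_iff)
    show "convex {x. ennreal (A * u) < f x}" "convex {x. ennreal (B * u) < g x}"
      using qf qg unfolding is_interval_convex_1[symmetric] is_interval_1
      by (auto simp: min_le_iff_disj) (metis less_le_trans)+
    show "{x. ennreal (c * u) < h x} \<in> sets lborel" by simp
    show "(1 - l) * x + l * y \<in> {x. ennreal (c * u) < h x}"
      if "x \<in> {x. ennreal (A * u) < f x}" "y \<in> {x. ennreal (B * u) < g x}" for x y
    proof -
      obtain a' b' where a': "0 \<le> a'" "f x = ennreal a'" and b': "0 \<le> b'" "g y = ennreal b'"
        using bdd[of x] bdd[of y] by (cases "f x"; cases "g y") (auto simp: top_unique)
      then have lt: "A * u < a'" "B * u < b'"
        using that A B u by (auto simp: ennreal_less_iff)
      have pos: "0 \<le> A * u" "0 \<le> B * u" using A B u by auto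
      have "(A * u) powr (1 - l) < a' powr (1 - l)" "(B * u) powr l < b' powr l"
        using lt pos l by (auto intro!: powr_less_mono2)
      then have "(A * u) powr (1 - l) * (B * u) powr l < a' powr (1 - l) * b' powr l"
        by (intro mult_strict_mono) (auto intro: le_less_trans[OF powr_ge_zero])
      then have "ennreal (c * u) < ennreal (a' powr (1 - l) * b' powr l)"
        using ce[OF u(1)] by (simp add: ennreal_less_iff)
      also have "\<dots> \<le> h ((1 - l) * x + l * y)"
        using a' b' by (intro h) auto
      finally show ?thesis by simp
    qed
  qed
  \<comment> \<open>Levels with \<open>u \<ge> 1\<close> contribute nothing, because
    \<open>D\<close> is the supremum. Thus \<open>f\<close> and \<open>g\<close> are integrated over
    the same range of \<open>u\<close>, the one on which both superlevel sets are nonempty.\<close>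
  have cut: "(\<integral>\<^sup>+x. k x \<partial>lborel) = ennreal D * (\<integral>\<^sup>+u. emeasure lborel {x. ennreal (D * u) < k x} * indicator {0..<1} u \<partial>lborel)"
    if [measurable]: "k \<in> borel_measurable borel" and D: "0 < D" "(SUP x. k x) = ennreal D" for k :: "real \<Rightarrow> ennreal" and D
  proof -
    have "emeasure lborel {x. ennreal (D * u) < k x} * indicator {0..} u = 
      emeasure lborel {x. ennreal (D * u) < k x} * indicator {0..<1} u" for u
    proof (cases "1 \<le> u")
      case True
      have "\<not> ennreal (D * u) < k x" for x
      proof -
        have "k x \<le> ennreal D" using SUP_upper[of x UNIV k] D by simp
        also have "\<dots> \<le> ennreal (D * u)" using D True by (intro ennreal_leI) auto
        finally show ?thesis by simp
      qed
      then show ?thesis by simp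
    qed (auto split: split_indicator)
    then show ?thesis
      using layer_cake[OF sigma_finite_lborel _ D(1), of k] by simp
  qed
  define If where "If = (\<integral>\<^sup>+u. emeasure lborel {x. ennreal (A * u) < f x} * indicator {0..<1} u \<partial>lborel)"
  define Ig where "Ig = (\<integral>\<^sup>+u. emeasure lborel {x. ennreal (B * u) < g x} * indicator {0..<1} u \<partial>lborel)"
  have [measurable]: "(\<lambda>u. emeasure lborel {x. ennreal (D * u) < k x}) \<in> borel_measurable borel"
    if [measurable]: "k \<in> borel_measurable borel" for D and k :: "real \<Rightarrow> ennreal"
  proof -
    have "(\<lambda>u. \<integral>\<^sup>+x. indicator {x. ennreal (D * u) < k x} x \<partial>lborel) \<in> borel_measurable borel"
      by measurable
    then show ?thesis by simp
  qed
  have fA: "ennreal (a / A) \<le> If"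
  proof -
    have "ennreal A * ennreal (a / A) \<le> ennreal A * If"
      using cut[OF _ A, folded If_def] ab A by (simp flip: ennreal_mult)
    then show ?thesis using A by (simp add: ennreal_mult_le_mult_iff)
  qed
  have gB: "ennreal (b / B) \<le> Ig"
  proof -
    have "ennreal B * ennreal (b / B) \<le> ennreal B * Ig"
      using cut[OF _ B, folded Ig_def] ab B by (simp flip: ennreal_mult)
    then show ?thesis using B by (simp add: ennreal_mult_le_mult_iff)
  qed
  \<comment> \<open>With integrals normalised by the suprema, Young's inequality bounds the weighted
    geometric mean of \<open>a / A\<close> and \<open>b / B\<close> by the arithmetic mean that
    Brunn-Minkowski controls.\<close>
  have "a powr (1 - l) * b powr l = c * ((a / A) powr (1 - l) * (b / B) powr l)"
    using ab A B by (simp add: c_def powr_divide)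
  also have "\<dots> \<le> c * ((1 - l) * (a / A) + l * (b / B))"
    using c A B ab l by (intro mult_left_mono Youngs_inequality_0) auto
  finally have "ennreal (a powr (1 - l) * b powr l) \<le> ennreal (c * ((1 - l) * (a / A) + l * (b / B)))"
    by (rule ennreal_leI)
  also have "\<dots> = ennreal c * (ennreal (1 - l) * ennreal (a / A) + ennreal l * ennreal (b / B))"
    using c A B ab l by (simp flip: ennreal_mult ennreal_plus)
  also have "\<dots> \<le> ennreal c * (ennreal (1 - l) * If + ennreal l * Ig)"
    by (intro mult_left_mono add_mono fA gB) auto
  also have "ennreal (1 - l) * If + ennreal l * Ig =
     (\<integral>\<^sup>+u. (ennreal (1 - l) * emeasure lborel {x. ennreal (A * u) < f x} +
       ennreal l * emeasure lborel {x. ennreal (B * u) < g x}) * indicator {0..<1} u \<partial>lborel)"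
    unfolding If_def Ig_def by (simp add: nn_integral_add nn_integral_cmult distrib_right mult.assoc)
  also have "\<dots> \<le> (\<integral>\<^sup>+u. emeasure lborel {x. ennreal (c * u) < h x} * indicator {0..} u \<partial>lborel)"
    using level by (intro nn_integral_mono) (auto split: split_indicator)
  also have "ennreal c * \<dots> = (\<integral>\<^sup>+x. h x \<partial>lborel)"
    using layer_cake[OF sigma_finite_lborel _ c, of h] by simp
  finally show ?thesis
    by (simp add: mult_left_mono)
qed

text \<open>Truncating \<open>f\<close> and \<open>g\<close> at a large integer keeps their
  superlevel sets intervals, and by monotone convergence the truncated integrals still exceed any
  \<open>a' < a\<close> and \<open>b' < b\<close>. The bounded case applies to these, and
  \<open>a'\<close>, \<open>b'\<close> then tend to \<open>a\<close>, \<open>b\<close>.\<close>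

lemma Prekopa_Leindler_real:
  fixes f g h :: "real \<Rightarrow> ennreal"
  assumes l: "0 < l" "l < 1"
    and [measurable]: "f \<in> borel_measurable borel" "g \<in> borel_measurable borel" "h \<in> borel_measurable borel"
    and qf: "\<And>x y z. x \<le> z \<Longrightarrow> z \<le> y \<Longrightarrow> min (f x) (f y) \<le> f z"
    and qg: "\<And>x y z. x \<le> z \<Longrightarrow> z \<le> y \<Longrightarrow> min (g x) (g y) \<le> g z"
    and h: "\<And>x y a b. 0 \<le> a \<Longrightarrow> 0 \<le> b \<Longrightarrow> ennreal a \<le> f x \<Longrightarrow> ennreal b \<le> g y \<Longrightarrow>
       ennreal (a powr (1 - l) * b powr l) \<le> h ((1 - l) * x + l * y)"
    and ab: "0 \<le> a" "0 \<le> b" "ennreal a \<le> (\<integral>\<^sup>+x. f x \<partial>lborel)" "ennreal b \<le> (\<integral>\<^sup>+x. g x \<partial>lborel)"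
  shows "ennreal (a powr (1 - l) * b powr l) \<le> (\<integral>\<^sup>+x. h x \<partial>lborel)"
proof (cases "a = 0 \<or> b = 0")
  case False
  have strict: "ennreal (a' powr (1 - l) * b' powr l) \<le> (\<integral>\<^sup>+x. h x \<partial>lborel)"
    if a': "0 < a'" "a' < a" and b': "0 < b'" "b' < b" for a' b'
  proof -
    have trunc: "(\<integral>\<^sup>+x. k x \<partial>lborel) = (SUP n. \<integral>\<^sup>+x. min (k x) (of_nat n) \<partial>lborel)"
      if [measurable]: "k \<in> borel_measurable borel" for k :: "real \<Rightarrow> ennreal"
    proof -
      have "k x = (SUP n. min (k x) (of_nat n))" for x
      proof -
        have "(SUP n. inf (k x) (of_nat n)) = inf (k x) (SUP n. of_nat n)"
          by (rule inf_SUP[symmetric])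
        then show ?thesis by (simp add: inf_min ennreal_SUP_of_nat_eq_top)
      qed
      then have "(\<integral>\<^sup>+x. k x \<partial>lborel) = (\<integral>\<^sup>+x. (SUP n. min (k x) (of_nat n)) \<partial>lborel)" by simp
      also have "\<dots> = (SUP n. \<integral>\<^sup>+x. min (k x) (of_nat n) \<partial>lborel)"
        by (rule nn_integral_monotone_convergence_SUP)
          (auto simp: incseq_def le_fun_def intro: min.coboundedI2 order_trans[OF _ of_nat_mono])
      finally show ?thesis .
    qed
    have "ennreal a' < (\<integral>\<^sup>+x. f x \<partial>lborel)" "ennreal b' < (\<integral>\<^sup>+x. g x \<partial>lborel)"
      using ab a' b' by (auto intro: less_le_trans[rotated] simp: ennreal_less_iff)
    then obtain m n where m: "ennreal a' < (\<integral>\<^sup>+x. min (f x) (of_nat m) \<partial>lborel)"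
      and n: "ennreal b' < (\<integral>\<^sup>+x. min (g x) (of_nat n) \<partial>lborel)"
      unfolding trunc[OF assms(3)] trunc[OF assms(4)] less_SUP_iff by auto
    show ?thesis
    proof (rule Prekopa_Leindler_real_bounded[OF l, where f="\<lambda>x. min (f x) (of_nat m)" and
          g = "\<lambda>x. min (g x) (of_nat n)" and N="real (max m n)"])
      show "min (min (f x) (of_nat m)) (min (f y) (of_nat m)) \<le> min (f z) (of_nat m)" if "x \<le> z" "z \<le> y" for x y z
        using qf[OF that] by (auto simp: min_le_iff_disj)
      show "min (min (g x) (of_nat n)) (min (g y) (of_nat n)) \<le> min (g z) (of_nat n)" if "x \<le> z" "z \<le> y" for x y z
        using qg[OF that] by (auto simp: min_le_iff_disj)
      have "(of_nat m :: ennreal) \<le> of_nat (max m n)" "(of_nat n :: ennreal) \<le> of_nat (max m n)"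
        by (auto intro: of_nat_mono)
      then show "min (f x) (of_nat m) \<le> ennreal (real (max m n))" "min (g x) (of_nat n) \<le> ennreal (real (max m n))" for x
        unfolding ennreal_of_nat_eq_real_of_nat[symmetric] by (auto intro: min.coboundedI2)
    qed (use m n a' b' in \<open>auto intro!: h\<close>)
  qed
  have pos: "0 < a" "0 < b" using False ab by auto
  have "((\<lambda>t. ennreal ((t * a) powr (1 - l) * (t * b) powr l)) \<longlongrightarrow> ennreal ((1 * a) powr (1 - l) * (1 * b) powr l)) (at_left 1)"
    using pos l by (intro tendsto_intros) auto
  moreover have "\<forall>\<^sub>F t in at_left 1. ennreal ((t * a) powr (1 - l) * (t * b) powr l) \<le> (\<integral>\<^sup>+x. h x \<partial>lborel)"
    using pos by (intro eventually_mono[OF eventually_at_left_real[of 0 1]]) (auto intro!: strict)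
  ultimately show ?thesis
    using tendsto_upperbound[of _ _ "at_left (1::real)"] by fastforce
qed auto

section \<open>Marginals of log-concave functions\<close>

text \<open>Real lower bounds of the values are compared because \<open>powr\<close> is not available on \<^typ>\<open>ennreal\<close>.\<close>

definition log_concave :: "(('i \<Rightarrow> real) \<Rightarrow> real \<Rightarrow> ennreal) \<Rightarrow> bool" where
  "log_concave \<phi> \<longleftrightarrow> (\<forall>l x y s t a b. 0 < l \<longrightarrow> l < 1 \<longrightarrow> 0 \<le> a \<longrightarrow> 0 \<le> b \<longrightarrow>
     ennreal a \<le> \<phi> x s \<longrightarrow> ennreal b \<le> \<phi> y t \<longrightarrow>
     ennreal (a powr (1 - l) * b powr l) \<le> \<phi> (\<lambda>i. (1 - l) * x i + l * y i) ((1 - l) * s + l * t))"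

lemma log_concaveD:
  assumes "log_concave \<phi>" "0 < l" "l < 1" "0 \<le> a" "0 \<le> b" "ennreal a \<le> \<phi> x s" "ennreal b \<le> \<phi> y t"
  shows "ennreal (a powr (1 - l) * b powr l) \<le> \<phi> (\<lambda>i. (1 - l) * x i + l * y i) ((1 - l) * s + l * t)"
  using assms unfolding log_concave_def by blast

lemma ennreal_le_via_real:
  fixes u v :: ennreal
  assumes "\<And>a. 0 \<le> a \<Longrightarrow> ennreal a \<le> u \<Longrightarrow> ennreal a \<le> v"
  shows "u \<le> v"
proof (cases u)
  case (real r)
  then show ?thesis using assms[of r] by simp
next
  case top
  show ?thesis
  proof (cases v)
    case (real r)
    then show ?thesis using assms[of "r + 1"] top by (simp del: ennreal_plus)
  qed simp
qed

text \<open>Prekopa's theorem on marginals, by induction on the integrated coordinates. Integrating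
  out all but the coordinate \<open>i\<close> leaves \<open>\<Phi> s t\<close>, which is jointly
  log-concave by the induction hypothesis; the one-dimensional inequality then integrates out
  \<open>s\<close>.\<close>

lemma Prekopa_PiM:
  fixes \<phi> :: "('i \<Rightarrow> real) \<Rightarrow> real \<Rightarrow> ennreal"
  assumes "finite I" "case_prod \<phi> \<in> borel_measurable (PiM I (\<lambda>_. lborel) \<Otimes>\<^sub>M borel)" "log_concave \<phi>"
    and l: "0 < l" "l < 1" and ab: "0 \<le> a" "0 \<le> b"
    and "ennreal a \<le> (\<integral>\<^sup>+y. \<phi> y s \<partial>PiM I (\<lambda>_. lborel))" "ennreal b \<le> (\<integral>\<^sup>+y. \<phi> y t \<partial>PiM I (\<lambda>_. lborel))"
  shows "ennreal (a powr (1 - l) * b powr l) \<le> (\<integral>\<^sup>+y. \<phi> y ((1 - l) * s + l * t) \<partial>PiM I (\<lambda>_. lborel))"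
  using assms
proof (induction I arbitrary: \<phi> l a b s t rule: finite_induct)
  case empty
  interpret product_sigma_finite "\<lambda>_::'i. lborel :: real measure" by standard
  \<comment> \<open>The empty product space consists of the single point that is
    \<open>undefined\<close> everywhere, and this point has to be recognised as its own convex
    combination.\<close>
  have eq: "(\<lambda>i. (1 - l) * undefined + l * undefined) = (\<lambda>i. undefined :: real)"
    by (simp add: algebra_simps)
  show ?case
    using log_concaveD[OF \<open>log_concave \<phi>\<close> empty(3-6), of "\<lambda>_. undefined" s "\<lambda>_. undefined" t] empty(7,8)
    by (simp add: nn_integral_empty eq)
next
  case (insert i I)
  interpret product_sigma_finite "\<lambda>_::'i. lborel :: real measure" by standard
  interpret P: finite_product_sigma_finite "\<lambda>_::'i. lborel :: real measure" I
    by standard (fact insert.hyps)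
  let ?P = "PiM I (\<lambda>_. lborel :: real measure)" and ?Q = "PiM (insert i I) (\<lambda>_. lborel :: real measure)"
  define \<Phi> where "\<Phi> s t = (\<integral>\<^sup>+x. \<phi> (x(i := s)) t \<partial>?P)" for s t
  have meas: "(\<lambda>(x, \<theta>). \<phi> (x(i := F \<theta>)) (G \<theta>)) \<in> borel_measurable (?P \<Otimes>\<^sub>M borel)"
    if [measurable]: "F \<in> borel_measurable borel" "G \<in> borel_measurable borel" for F G :: "real \<Rightarrow> real"
  proof -
    have 1: "(\<lambda>(f, y). f(i := y)) \<in> ?P \<Otimes>\<^sub>M lborel \<rightarrow>\<^sub>M ?Q"
      by (rule measurable_add_dim)
    have 2: "(\<lambda>(x, \<theta>). (x, F \<theta>)) \<in> ?P \<Otimes>\<^sub>M borel \<rightarrow>\<^sub>M ?P \<Otimes>\<^sub>M lborel"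
      by measurable
    note [measurable] = measurable_compose[OF 2 1]
    have "(\<lambda>z. (case (case z of (x, \<theta>) \<Rightarrow> (x, F \<theta>)) of (f, y) \<Rightarrow> f(i := y), G (snd z))) \<in> ?P \<Otimes>\<^sub>M borel \<rightarrow>\<^sub>M ?Q \<Otimes>\<^sub>M borel"
      by measurable
    from measurable_compose[OF this insert.prems(1)] show ?thesis
      by (simp add: case_prod_beta)
  qed
  have \<Phi>: "ennreal (a powr (1 - l) * b powr l) \<le> \<Phi> ((1 - l) * s + l * s') ((1 - l) * t + l * t')"
    if "0 < l" "l < 1" "0 \<le> a" "0 \<le> b" "ennreal a \<le> \<Phi> s t" "ennreal b \<le> \<Phi> s' t'" for a b s s' t t' l
  proof -
    \<comment> \<open>The induction hypothesis has room for one real parameter, while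
      \<open>\<Phi>\<close> has two. Both are therefore moved along the segment from
      \<open>(s, t)\<close> to \<open>(s', t')\<close>, with \<open>\<theta>\<close> running from 0
      to 1.\<close>
    define \<phi>' where "\<phi>' x \<theta> = \<phi> (x(i := (1 - \<theta>) * s + \<theta> * s')) ((1 - \<theta>) * t + \<theta> * t')" for x \<theta>
    have "log_concave \<phi>'"
      unfolding log_concave_def
    proof (intro allI impI)
      fix l x y \<theta> \<theta>' a b
      assume *: "0 < (l::real)" "l < 1" "0 \<le> (a::real)" "0 \<le> (b::real)" "ennreal a \<le> \<phi>' x \<theta>" "ennreal b \<le> \<phi>' y \<theta>'"
      have 1: "(\<lambda>j. (1 - l) * (x(i := (1 - \<theta>) * s + \<theta> * s')) j + l * (y(i := (1 - \<theta>') * s + \<theta>' * s')) j) =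
        (\<lambda>j. (1 - l) * x j + l * y j)(i := (1 - ((1 - l) * \<theta> + l * \<theta>')) * s + ((1 - l) * \<theta> + l * \<theta>') * s')"
        by (rule ext) (auto simp: algebra_simps)
      have 2: "(1 - l) * ((1 - \<theta>) * t + \<theta> * t') + l * ((1 - \<theta>') * t + \<theta>' * t') =
         (1 - ((1 - l) * \<theta> + l * \<theta>')) * t + ((1 - l) * \<theta> + l * \<theta>') * t'"
        by (simp add: algebra_simps)
      show "ennreal (a powr (1 - l) * b powr l) \<le> \<phi>' (\<lambda>i. (1 - l) * x i + l * y i) ((1 - l) * \<theta> + l * \<theta>')"
        using log_concaveD[OF insert.prems(2) *(1-4), where
            x="x(i := (1 - \<theta>) * s + \<theta> * s')" and s="(1 - \<theta>) * t + \<theta> * t'" and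
            y="y(i := (1 - \<theta>') * s + \<theta>' * s')" and t="(1 - \<theta>') * t + \<theta>' * t'"] *(5,6)
        unfolding \<phi>'_def 1 2 by blast
    qed
    have "case_prod \<phi>' \<in> borel_measurable (?P \<Otimes>\<^sub>M borel)"
      unfolding \<phi>'_def by (rule meas) measurable
    note IH = insert.IH[OF this \<open>log_concave \<phi>'\<close> that(1-4), of 0 1]
    have "ennreal a \<le> (\<integral>\<^sup>+y. \<phi>' y 0 \<partial>?P)" "ennreal b \<le> (\<integral>\<^sup>+y. \<phi>' y 1 \<partial>?P)"
      using that(5,6) by (simp_all add: \<phi>'_def \<Phi>_def)
    from IH[OF this] have "ennreal (a powr (1 - l) * b powr l) \<le> (\<integral>\<^sup>+y. \<phi>' y ((1 - l) * 0 + l * 1) \<partial>?P)" .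
    then show ?thesis by (simp add: \<phi>'_def \<Phi>_def)
  qed
  \<comment> \<open>Log-concavity with both lower bounds equal to \<open>a\<close> gives
    quasi-concavity in the first variable, as the one-dimensional inequality demands.\<close>
  have qc: "min (\<Phi> x t) (\<Phi> y t) \<le> \<Phi> z t" if "x \<le> z" "z \<le> y" for x y z t
  proof (cases "x = z \<or> z = y")
    case False
    define \<theta> where "\<theta> = (z - x) / (y - x)"
    have \<theta>: "0 < \<theta>" "\<theta> < 1" "(1 - \<theta>) * x + \<theta> * y = z" "(1 - \<theta>) * t + \<theta> * t = t"
      using False that by (auto simp: \<theta>_def divide_simps) (auto simp: algebra_simps)
    show ?thesis
    proof (rule ennreal_le_via_real)
      fix a :: real assume a: "0 \<le> a" "ennreal a \<le> min (\<Phi> x t) (\<Phi> y t)"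
      have "a powr (1 - \<theta>) * a powr \<theta> = a"
        using a \<theta> by (simp flip: powr_add)
      then show "ennreal a \<le> \<Phi> z t"
        using \<Phi>[of \<theta> a a x t y t] a \<theta> by simp
    qed
  qed auto
  have [measurable]: "(\<lambda>s. \<Phi> s t) \<in> borel_measurable borel" for t
  proof -
    have "(\<lambda>(s, x). \<phi> (x(i := s)) t) \<in> borel_measurable (borel \<Otimes>\<^sub>M ?P)"
      using measurable_compose[OF measurable_pair_swap' meas[of "\<lambda>s. s" "\<lambda>_. t"]]
      by (simp add: case_prod_beta)
    then show ?thesis unfolding \<Phi>_def
      by (rule P.borel_measurable_nn_integral)
  qed
  have int: "(\<integral>\<^sup>+y. \<phi> y t \<partial>?Q) = (\<integral>\<^sup>+s. \<Phi> s t \<partial>lborel)" for t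
    unfolding \<Phi>_def
  proof (rule product_nn_integral_insert_rev)
    have "(\<lambda>y. (y, t)) \<in> ?Q \<rightarrow>\<^sub>M ?Q \<Otimes>\<^sub>M borel" by measurable
    from measurable_compose[OF this insert.prems(1)] show "(\<lambda>y. \<phi> y t) \<in> borel_measurable ?Q" by simp
  qed (use insert.hyps in auto)
  show ?case
    unfolding int
    by (rule Prekopa_Leindler_real[OF \<open>0 < l\<close> \<open>l < 1\<close>, where f="\<lambda>u. \<Phi> u s" and g="\<lambda>u. \<Phi> u t"])
      (use insert.prems in \<open>auto intro: qc \<Phi> simp: int\<close>)
qed

section \<open>Volumes of parallel sections of symmetric convex sets\<close>

lemma lborel_distr_uminus_euclidean: "distr lborel borel uminus = (lborel :: 'a::euclidean_space measure)"
  using lborel_affine[of "-1" "0 :: 'a"] by (simp add: density_1)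

text \<open>The indicator of a convex set is log-concave, so by Prekopa the section volume
  \<open>V\<close> is log-concave; it is even by the symmetry of \<open>K\<close>. As
  \<open>s\<close> is a convex combination of \<open>t\<close> and \<open>- t\<close>, its volume is
  at least the geometric mean of two copies of \<open>V t\<close>.\<close>

lemma section_measure_mono:
  fixes K :: "('a::euclidean_space \<times> real) set"
  assumes [measurable]: "K \<in> sets borel" and cv: "convex K" and sym: "\<And>z. z \<in> K \<Longrightarrow> - z \<in> K"
    and st: "\<bar>s\<bar> \<le> \<bar>t\<bar>"
  shows "emeasure lborel {y. (y, t) \<in> K} \<le> emeasure lborel {y. (y, s) \<in> K}"
proof -
  define V where "V t = emeasure lborel {y. (y, t) \<in> K}" for t
  let ?P = "PiM (Basis :: 'a set) (\<lambda>_. lborel :: real measure)"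
  define \<phi> :: "('a \<Rightarrow> real) \<Rightarrow> real \<Rightarrow> ennreal" where "\<phi> f t = indicator K (\<Sum>b\<in>Basis. f b *\<^sub>R b, t)" for f t
  have Kp[measurable]: "K \<in> sets (borel \<Otimes>\<^sub>M borel)" unfolding borel_prod by simp
  have [measurable]: "{y. (y, t) \<in> K} \<in> sets borel" for t
    using measurable_sets[of "\<lambda>y. (y, t)" borel "borel \<Otimes>\<^sub>M borel" K] by (simp add: vimage_def)
  have [measurable]: "case_prod \<phi> \<in> borel_measurable (?P \<Otimes>\<^sub>M borel)"
    unfolding \<phi>_def by measurable
  have V: "V t = (\<integral>\<^sup>+f. \<phi> f t \<partial>?P)" for t
  proof -
    have "V t = (\<integral>\<^sup>+y. indicator {y. (y, t) \<in> K} y \<partial>lborel)"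
      by (simp add: V_def)
    also have "\<dots> = (\<integral>\<^sup>+f. indicator {y. (y, t) \<in> K} (\<Sum>b\<in>Basis. f b *\<^sub>R b) \<partial>?P)"
      by (subst lborel_eq, subst nn_integral_distr) auto
    also have "\<dots> = (\<integral>\<^sup>+f. \<phi> f t \<partial>?P)"
      by (auto simp: \<phi>_def indicator_def)
    finally show ?thesis .
  qed
  have lc: "log_concave \<phi>"
    unfolding log_concave_def
  proof (intro allI impI)
    fix l x y s t a b
    assume *: "0 < (l::real)" "l < 1" "0 \<le> (a::real)" "0 \<le> (b::real)" "ennreal a \<le> \<phi> x s" "ennreal b \<le> \<phi> y t"
    show "ennreal (a powr (1 - l) * b powr l) \<le> \<phi> (\<lambda>i. (1 - l) * x i + l * y i) ((1 - l) * s + l * t)"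
    proof (cases "a = 0 \<or> b = 0")
      case False
      then have a: "0 < a" "0 < b" using * by auto
      have x: "(\<Sum>b\<in>Basis. x b *\<^sub>R b, s) \<in> K" "a \<le> 1"
        using * a by (auto simp: \<phi>_def split: split_indicator_asm)
      have y: "(\<Sum>b\<in>Basis. y b *\<^sub>R b, t) \<in> K" "b \<le> 1"
        using * a by (auto simp: \<phi>_def split: split_indicator_asm)
      have "(1 - l) *\<^sub>R (\<Sum>b\<in>Basis. x b *\<^sub>R b, s) + l *\<^sub>R (\<Sum>b\<in>Basis. y b *\<^sub>R b, t) \<in> K"
        using convexD[OF cv x(1) y(1), of "1 - l" l] * by simp
      moreover have "(1 - l) *\<^sub>R (\<Sum>b\<in>Basis. x b *\<^sub>R b, s) + l *\<^sub>R (\<Sum>b\<in>Basis. y b *\<^sub>R b, t) =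
        (\<Sum>b\<in>Basis. ((1 - l) * x b + l * y b) *\<^sub>R b, (1 - l) * s + l * t)"
        by (simp add: scaleR_sum_right sum.distrib scaleR_add_left)
      ultimately have 1: "\<phi> (\<lambda>i. (1 - l) * x i + l * y i) ((1 - l) * s + l * t) = 1"
        by (simp add: \<phi>_def)
      have "a powr (1 - l) * b powr l \<le> 1"
        using a x y * by (intro mult_le_one powr_le1) auto
      then show ?thesis unfolding 1 by simp
    qed auto
  qed
  have neg: "V (- t) = V t" for t
  proof -
    have "V (- t) = emeasure (distr lborel borel uminus) {y. (y, - t) \<in> K}"
      by (simp add: V_def lborel_distr_uminus_euclidean)
    also have "\<dots> = emeasure lborel {y. (- y, - t) \<in> K}"
      by (subst emeasure_distr) (auto simp: vimage_def)
    also have "{y. (- y, - t) \<in> K} = {y. (y, t) \<in> K}"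
      using sym[of "(_, _)"] by force
    finally show ?thesis by (simp add: V_def)
  qed
  show ?thesis
  proof (cases "\<bar>s\<bar> = \<bar>t\<bar>")
    case True
    then have "s = t \<or> s = - t" by auto
    then show ?thesis using neg[of t] by (auto simp: V_def)
  next
    case False
    \<comment> \<open>The weight that solves \<open>(1 - l) * t + l * (- t) = s\<close>; it lies
      strictly between 0 and 1 because \<open>\<bar>s\<bar> < \<bar>t\<bar>\<close>.\<close>
    define l where "l = (t - s) / (2 * t)"
    have t: "t \<noteq> 0" using st False by auto
    have l: "0 < l" "l < 1" and eq: "(1 - l) * t + l * (- t) = s"
      using st False t by (auto simp: l_def field_simps zero_less_divide_iff abs_if split: if_splits)
    have "V t \<le> V s"
    proof (rule ennreal_le_via_real)
      fix a :: real assume a: "0 \<le> a" "ennreal a \<le> V t"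
      have "a powr (1 - l) * a powr l = a"
        using a l by (simp flip: powr_add)
      then show "ennreal a \<le> V s"
        using Prekopa_PiM[of Basis \<phi> l a a t "- t"] lc l a neg[of t] eq by (simp add: V)
    qed
    then show ?thesis by (simp add: V_def)
  qed
qed

section \<open>Slices of products of unimodal functions\<close>

text \<open>Evenness is included: for \<open>\<bar>s\<bar> = \<bar>t\<bar>\<close> the comparison
  applies in both directions.\<close>

definition unimodal :: "(real \<Rightarrow> ennreal) \<Rightarrow> bool" where
  "unimodal q \<longleftrightarrow> q \<in> borel_measurable borel \<and> (\<forall>s t. \<bar>s\<bar> \<le> \<bar>t\<bar> \<longrightarrow> q t \<le> q s)"

lemma convex_symmetric_interval:
  fixes S :: "real set"
  assumes "\<And>s t. t \<in> S \<Longrightarrow> \<bar>s\<bar> \<le> \<bar>t\<bar> \<Longrightarrow> s \<in> S"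
  shows "convex S"
  unfolding is_interval_convex_1[symmetric] is_interval_1
proof (intro ballI allI impI)
  fix a b x assume "a \<in> S" "b \<in> S" "a \<le> x \<and> x \<le> b"
  then show "x \<in> S"
    using assms[of a x] assms[of b x] by linarith
qed

text \<open>Each unimodal factor is a mixture of indicators of symmetric intervals, which are absorbed
  into \<open>K\<close> one after the other.\<close>

lemma unimodal_product_section_mono:
  fixes a :: "'n \<Rightarrow> 'a::euclidean_space \<times> real"
  assumes "finite S" "\<And>i. i \<in> S \<Longrightarrow> unimodal (q i)"
    and "K \<in> sets borel" "convex K" "\<And>z. z \<in> K \<Longrightarrow> - z \<in> K" "\<bar>s\<bar> \<le> \<bar>t\<bar>"
  shows "(\<integral>\<^sup>+y. indicator K (y, t) * (\<Prod>i\<in>S. q i ((y, t) \<bullet> a i)) \<partial>lborel) \<le>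
         (\<integral>\<^sup>+y. indicator K (y, s) * (\<Prod>i\<in>S. q i ((y, s) \<bullet> a i)) \<partial>lborel)"
  using assms
proof (induction S arbitrary: K rule: finite_induct)
  case empty
  have "(\<integral>\<^sup>+y. indicator K (y, t) \<partial>lborel) = emeasure lborel {y. (y, t) \<in> K}" for t
  proof -
    have "K \<in> sets (borel \<Otimes>\<^sub>M borel)" unfolding borel_prod by (fact empty)
    from measurable_sets[OF _ this, of "\<lambda>y. (y, t)" borel] have "{y. (y, t) \<in> K} \<in> sets borel"
      by (simp add: vimage_def)
    then have "emeasure lborel {y. (y, t) \<in> K} = (\<integral>\<^sup>+y. indicator {y. (y, t) \<in> K} y \<partial>lborel)"
      by simp
    then show ?thesis by (simp add: indicator_def)
  qed
  then show ?case
    using section_measure_mono[of K s t] empty by simp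
next
  case (insert i S)
  have [measurable]: "q j \<in> borel_measurable borel" if "j \<in> insert i S" for j
    using insert.prems(1)[OF that] by (simp add: unimodal_def)
  have Kp[measurable]: "K \<in> sets (borel \<Otimes>\<^sub>M borel)" unfolding borel_prod by (fact insert)
  \<comment> \<open>\<open>L u\<close> is again convex and symmetric, so it can take the place of
    \<open>K\<close> in the induction. The condition \<open>0 \<le> u\<close> discards negative
    levels, which \<open>ennreal\<close> would count as level 0.\<close>
  define L where "L u = K \<inter> {z. 0 \<le> u \<and> ennreal u < q i (z \<bullet> a i)}" for u :: real
  have L: "(\<integral>\<^sup>+y. indicator K (y, t) * (\<Prod>i\<in>insert i S. q i ((y, t) \<bullet> a i)) \<partial>lborel) =
    (\<integral>\<^sup>+u. \<integral>\<^sup>+y. indicator (L u) (y, t) * (\<Prod>i\<in>S. q i ((y, t) \<bullet> a i)) \<partial>lborel \<partial>lborel)" for t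
  proof -
    have "indicator K (y, t) * (\<Prod>i\<in>insert i S. q i ((y, t) \<bullet> a i)) =
        (\<integral>\<^sup>+u. indicator (L u) (y, t) * (\<Prod>i\<in>S. q i ((y, t) \<bullet> a i)) \<partial>lborel)" for y
    proof -
      have "q i ((y, t) \<bullet> a i) = (\<integral>\<^sup>+u. indicator {u. 0 \<le> u \<and> ennreal u < q i ((y, t) \<bullet> a i)} u \<partial>lborel)"
        using level_emeasure[of 1 "q i ((y, t) \<bullet> a i)"] by simp
      then have "indicator K (y, t) * (\<Prod>i\<in>insert i S. q i ((y, t) \<bullet> a i)) =
        (\<integral>\<^sup>+u. indicator {u. 0 \<le> u \<and> ennreal u < q i ((y, t) \<bullet> a i)} u \<partial>lborel) *
        (indicator K (y, t) * (\<Prod>i\<in>S. q i ((y, t) \<bullet> a i)))"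
        using insert.hyps by (simp add: mult_ac)
      also have "\<dots> = (\<integral>\<^sup>+u. indicator {u. 0 \<le> u \<and> ennreal u < q i ((y, t) \<bullet> a i)} u *
        (indicator K (y, t) * (\<Prod>i\<in>S. q i ((y, t) \<bullet> a i))) \<partial>lborel)"
        by (rule nn_integral_multc[symmetric]) measurable
      also have "\<dots> = (\<integral>\<^sup>+u. indicator (L u) (y, t) * (\<Prod>i\<in>S. q i ((y, t) \<bullet> a i)) \<partial>lborel)"
        by (intro nn_integral_cong) (auto simp: L_def split: split_indicator)
      finally show ?thesis .
    qed
    then have "(\<integral>\<^sup>+y. indicator K (y, t) * (\<Prod>i\<in>insert i S. q i ((y, t) \<bullet> a i)) \<partial>lborel) =
      (\<integral>\<^sup>+y. \<integral>\<^sup>+u. indicator (L u) (y, t) * (\<Prod>i\<in>S. q i ((y, t) \<bullet> a i)) \<partial>lborel \<partial>lborel)"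
      by simp
    also have "\<dots> = (\<integral>\<^sup>+u. \<integral>\<^sup>+y. indicator (L u) (y, t) * (\<Prod>i\<in>S. q i ((y, t) \<bullet> a i)) \<partial>lborel \<partial>lborel)"
    proof (rule lborel_pair.Fubini'[symmetric])
      have "(\<lambda>(y, u). indicator (L u) (y, t) * (\<Prod>i\<in>S. q i ((y, t) \<bullet> a i))) =
        (\<lambda>(y, u). indicator K (y, t) * indicator {(y, u). 0 \<le> u \<and> ennreal u < q i ((y, t) \<bullet> a i)} (y, u) * (\<Prod>i\<in>S. q i ((y, t) \<bullet> a i)))"
        by (auto simp: L_def fun_eq_iff split: split_indicator)
      also have "\<dots> \<in> borel_measurable (lborel \<Otimes>\<^sub>M lborel)"
        by measurable
      finally show "(\<lambda>(y, u). indicator (L u) (y, t) * (\<Prod>i\<in>S. q i ((y, t) \<bullet> a i))) \<in> borel_measurable (lborel \<Otimes>\<^sub>M lborel)" .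
    qed
    finally show ?thesis .
  qed
  show ?case
    unfolding L
  proof (rule nn_integral_mono)
    fix u :: real
    have um: "0 \<le> u \<and> ennreal u < q i s'" if "0 \<le> u \<and> ennreal u < q i t'" "\<bar>s'\<bar> \<le> \<bar>t'\<bar>" for s' t'
      using insert.prems(1)[of i] that by (auto simp: unimodal_def intro: less_le_trans)
    have cv: "convex {x. 0 \<le> u \<and> ennreal u < q i x}"
      by (rule convex_symmetric_interval) (use um in blast)
    have eq: "{z. 0 \<le> u \<and> ennreal u < q i (z \<bullet> a i)} = (\<lambda>z. z \<bullet> a i) -` {x. 0 \<le> u \<and> ennreal u < q i x}"
      by auto
    have "convex (L u)"
      unfolding L_def eq
      by (intro convex_Int insert.prems convex_linear_vimage cv) (simp add: bounded_linear.linear bounded_linear_inner_left)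
    moreover have "L u \<in> sets borel"
      unfolding L_def
      by (intro sets.Int insert.prems) measurable
    moreover have "- z \<in> L u" if "z \<in> L u" for z
      using that insert.prems(4) um[of "z \<bullet> a i" "- z \<bullet> a i"] by (auto simp: L_def)
    ultimately show "(\<integral>\<^sup>+y. indicator (L u) (y, t) * (\<Prod>i\<in>S. q i ((y, t) \<bullet> a i)) \<partial>lborel) \<le>
         (\<integral>\<^sup>+y. indicator (L u) (y, s) * (\<Prod>i\<in>S. q i ((y, s) \<bullet> a i)) \<partial>lborel)"
      using insert.prems by (intro insert.IH) auto
  qed
qed

section \<open>Integration over parallel slices and the single-crossing inequality\<close>

lemma nn_integral_lborel_translate:
  fixes F :: "'a::euclidean_space \<Rightarrow> ennreal"
  assumes [measurable]: "F \<in> borel_measurable borel"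
  shows "(\<integral>\<^sup>+y. F (y + c) \<partial>lborel) = (\<integral>\<^sup>+y. F y \<partial>lborel)"
proof -
  have "(\<integral>\<^sup>+y. F y \<partial>lborel) = (\<integral>\<^sup>+y. F y \<partial>distr lborel borel ((+) c))"
    by (simp add: lborel_distr_plus)
  also have "\<dots> = (\<integral>\<^sup>+y. F (c + y) \<partial>lborel)"
    by (subst nn_integral_distr) auto
  finally show ?thesis by (simp add: add.commute)
qed

text \<open>A coordinate-free Fubini theorem along \<open>v\<close>: average the translates of the left-hand side
  by multiples of \<open>v\<close> against the indicator of \<open>[-1, 1]\<close>.\<close>

lemma disintegration:
  fixes v :: "'a::euclidean_space" and Q :: "'a \<Rightarrow> ennreal" and f :: "real \<Rightarrow> ennreal"
  assumes [measurable]: "Q \<in> borel_measurable borel" "f \<in> borel_measurable borel" and v: "v \<noteq> 0"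
  shows "2 * (\<integral>\<^sup>+y. Q y * f (y \<bullet> v) \<partial>lborel) =
    (\<integral>\<^sup>+t. f t * (\<integral>\<^sup>+y. indicator {-1..1} (y \<bullet> v) * Q (y + ((t - y \<bullet> v) / (v \<bullet> v)) *\<^sub>R v) \<partial>lborel) \<partial>lborel)"
proof -
  define c where "c = v \<bullet> v"
  have c: "0 < c" using v by (simp add: c_def)
  define J where "J = (\<integral>\<^sup>+y. Q y * f (y \<bullet> v) \<partial>lborel)"
  \<comment> \<open>The values \<open>s\<close> with \<open>r - s * c\<close> in
    \<open>[-1, 1]\<close> form an interval of length \<open>2 / c\<close> whatever \<open>r\<close>
    is; this is the source of the factor 2.\<close>
  have two: "ennreal c * (\<integral>\<^sup>+s. indicator {-1..1} (r - s * c) \<partial>lborel) = 2" for r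
  proof -
    have "(\<integral>\<^sup>+s. indicator {-1..1::real} s \<partial>lborel) = ennreal \<bar>- c\<bar> * (\<integral>\<^sup>+s. indicator {-1..1} (r + (- c) * s) \<partial>lborel)"
      using c by (subst nn_integral_real_affine[of "indicator {-1..1}" "- c" r]) auto
    then show ?thesis using c by (simp add: mult.commute)
  qed
  have [measurable]: "(\<lambda>(s, y). Q (y + s *\<^sub>R v)) \<in> borel_measurable (lborel \<Otimes>\<^sub>M lborel)"
    by measurable
  have "2 * J = (\<integral>\<^sup>+y. (Q y * f (y \<bullet> v)) * (ennreal c * (\<integral>\<^sup>+s. indicator {-1..1} (y \<bullet> v - s * c) \<partial>lborel)) \<partial>lborel)"
    unfolding two J_def by (subst nn_integral_multc) (auto simp: mult.commute)
  also have "\<dots> = (\<integral>\<^sup>+y. \<integral>\<^sup>+s. ennreal c * (Q y * f (y \<bullet> v) * indicator {-1..1} (y \<bullet> v - s * c)) \<partial>lborel \<partial>lborel)"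
    by (intro nn_integral_cong) (simp add: nn_integral_cmult[symmetric] mult_ac)
  also have "\<dots> = (\<integral>\<^sup>+s. \<integral>\<^sup>+y. ennreal c * (Q y * f (y \<bullet> v) * indicator {-1..1} (y \<bullet> v - s * c)) \<partial>lborel \<partial>lborel)"
    by (rule lborel_pair.Fubini'[symmetric]) measurable
  \<comment> \<open>Translating \<open>y\<close> by \<open>s *\<^sub>R v\<close> raises
    \<open>y \<bullet> v\<close> by \<open>s * c\<close>, which frees the indicator from
    \<open>s\<close>. The substitution \<open>t = y \<bullet> v + c * s\<close> follows.\<close>
  also have "\<dots> = (\<integral>\<^sup>+s. \<integral>\<^sup>+y. ennreal c * (Q (y + s *\<^sub>R v) * f (y \<bullet> v + s * c) * indicator {-1..1} (y \<bullet> v)) \<partial>lborel \<partial>lborel)"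
  proof (rule nn_integral_cong)
    fix s :: real
    show "(\<integral>\<^sup>+y. ennreal c * (Q y * f (y \<bullet> v) * indicator {-1..1} (y \<bullet> v - s * c)) \<partial>lborel) =
      (\<integral>\<^sup>+y. ennreal c * (Q (y + s *\<^sub>R v) * f (y \<bullet> v + s * c) * indicator {-1..1} (y \<bullet> v)) \<partial>lborel)"
      by (subst nn_integral_lborel_translate[of _ "s *\<^sub>R v", symmetric])
        (auto simp: inner_add_left c_def)
  qed
  also have "\<dots> = (\<integral>\<^sup>+y. \<integral>\<^sup>+s. ennreal c * (Q (y + s *\<^sub>R v) * f (y \<bullet> v + s * c) * indicator {-1..1} (y \<bullet> v)) \<partial>lborel \<partial>lborel)"
    by (rule lborel_pair.Fubini') measurable
  also have "\<dots> = (\<integral>\<^sup>+y. \<integral>\<^sup>+t. Q (y + ((t - y \<bullet> v) / c) *\<^sub>R v) * f t * indicator {-1..1} (y \<bullet> v) \<partial>lborel \<partial>lborel)"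
  proof (rule nn_integral_cong)
    fix y :: 'a
    have "(\<integral>\<^sup>+t. Q (y + ((t - y \<bullet> v) / c) *\<^sub>R v) * f t * indicator {-1..1} (y \<bullet> v) \<partial>lborel) =
      ennreal \<bar>c\<bar> * (\<integral>\<^sup>+s. Q (y + s *\<^sub>R v) * f (y \<bullet> v + c * s) * indicator {-1..1} (y \<bullet> v) \<partial>lborel)"
      using c by (subst nn_integral_real_affine[of _ c "y \<bullet> v"]) auto
    then show "(\<integral>\<^sup>+s. ennreal c * (Q (y + s *\<^sub>R v) * f (y \<bullet> v + s * c) * indicator {-1..1} (y \<bullet> v)) \<partial>lborel) =
      (\<integral>\<^sup>+t. Q (y + ((t - y \<bullet> v) / c) *\<^sub>R v) * f t * indicator {-1..1} (y \<bullet> v) \<partial>lborel)"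
      using c by (simp add: nn_integral_cmult[symmetric] mult.commute)
  qed
  also have "\<dots> = (\<integral>\<^sup>+t. \<integral>\<^sup>+y. Q (y + ((t - y \<bullet> v) / c) *\<^sub>R v) * f t * indicator {-1..1} (y \<bullet> v) \<partial>lborel \<partial>lborel)"
    using c by (intro lborel_pair.Fubini'[symmetric]) measurable
  also have "\<dots> = (\<integral>\<^sup>+t. f t * (\<integral>\<^sup>+y. indicator {-1..1} (y \<bullet> v) * Q (y + ((t - y \<bullet> v) / c) *\<^sub>R v) \<partial>lborel) \<partial>lborel)"
    using c by (intro nn_integral_cong) (simp add: nn_integral_cmult[symmetric] mult_ac)
  finally show ?thesis unfolding J_def c_def .
qed

text \<open>The difference \<open>f - g\<close> has integral 0, is nonnegative where
  \<open>m \<ge> m t0\<close> and nonpositive where \<open>m \<le> m t0\<close>; so formally the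
  integral of \<open>(f - g) * (m - m t0)\<close> is nonnegative. To stay within nonnegative
  functions, \<open>f\<close> and \<open>g\<close> are split into a common part \<open>k\<close> and
  excesses \<open>u\<close> and \<open>w\<close>, which have equal integrals.\<close>

lemma crossing:
  fixes f g :: "real \<Rightarrow> real" and m :: "real \<Rightarrow> ennreal"
  assumes [measurable]: "f \<in> borel_measurable borel" "g \<in> borel_measurable borel" "m \<in> borel_measurable borel"
    and nn: "\<And>t. 0 \<le> f t" "\<And>t. 0 \<le> g t"
    and m: "\<And>s t. \<bar>s\<bar> \<le> \<bar>t\<bar> \<Longrightarrow> m t \<le> m s"
    and near: "\<And>t. \<bar>t\<bar> \<le> t0 \<Longrightarrow> g t \<le> f t" and far: "\<And>t. t0 \<le> \<bar>t\<bar> \<Longrightarrow> f t \<le> g t" and "0 \<le> t0"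
    and eq: "(\<integral>\<^sup>+t. f t \<partial>lborel) = (\<integral>\<^sup>+t. g t \<partial>lborel)" and fin: "(\<integral>\<^sup>+t. f t \<partial>lborel) \<noteq> \<infinity>"
  shows "(\<integral>\<^sup>+t. g t * m t \<partial>lborel) \<le> (\<integral>\<^sup>+t. f t * m t \<partial>lborel)"
proof -
  define k where "k t = ennreal (min (f t) (g t))" for t
  define u where "u t = ennreal (max 0 (f t - g t))" for t
  define w where "w t = ennreal (max 0 (g t - f t))" for t
  have [measurable]: "k \<in> borel_measurable borel" "u \<in> borel_measurable borel" "w \<in> borel_measurable borel"
    unfolding k_def u_def w_def by measurable
  have f: "ennreal (f t) = k t + u t" and g: "ennreal (g t) = k t + w t" for t
    using nn by (auto simp: k_def u_def w_def min_def max_def simp flip: ennreal_plus)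
  have "(\<integral>\<^sup>+t. k t \<partial>lborel) + (\<integral>\<^sup>+t. u t \<partial>lborel) = (\<integral>\<^sup>+t. k t \<partial>lborel) + (\<integral>\<^sup>+t. w t \<partial>lborel)"
    using eq unfolding f g by (simp add: nn_integral_add)
  moreover have "(\<integral>\<^sup>+t. k t \<partial>lborel) \<le> (\<integral>\<^sup>+t. f t \<partial>lborel)"
    unfolding k_def by (intro nn_integral_mono ennreal_leI) auto
  ultimately have uw: "(\<integral>\<^sup>+t. u t \<partial>lborel) = (\<integral>\<^sup>+t. w t \<partial>lborel)"
    using fin by (auto simp: ennreal_add_left_cancel top_unique)
  have "(\<integral>\<^sup>+t. w t * m t \<partial>lborel) \<le> (\<integral>\<^sup>+t. w t * m t0 \<partial>lborel)"
  proof (rule nn_integral_mono)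
    fix t show "w t * m t \<le> w t * m t0"
      using m[of t0 t] near[of t] \<open>0 \<le> t0\<close>
      by (cases "\<bar>t\<bar> \<le> t0") (auto simp: w_def max_def intro!: mult_left_mono)
  qed
  also have "\<dots> = (\<integral>\<^sup>+t. u t * m t0 \<partial>lborel)"
    using uw by (simp add: nn_integral_multc)
  also have "\<dots> \<le> (\<integral>\<^sup>+t. u t * m t \<partial>lborel)"
  proof (rule nn_integral_mono)
    fix t show "u t * m t0 \<le> u t * m t"
      using m[of t t0] far[of t] \<open>0 \<le> t0\<close>
      by (cases "\<bar>t\<bar> \<le> t0") (auto simp: u_def max_def intro!: mult_left_mono)
  qed
  finally show ?thesis
    unfolding f g by (simp add: distrib_right nn_integral_add add_left_mono)
qed

section \<open>Exchanging one factor at a time\<close>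

text \<open>Disintegrating along \<open>v j\<close>, the remaining factors integrate over the slices
  to an even function \<open>m\<close> decreasing in \<open>\<bar>t\<bar>\<close>, and
  \<open>crossing\<close> compares \<open>f\<close> with \<open>g\<close> against \<open>m\<close>.
  If \<open>v j = 0\<close> the factor is constant, whence the hypothesis
  \<open>f 0 = g 0\<close>.\<close>

lemma replace_factor_mono:
  fixes v :: "'n \<Rightarrow> 'a::euclidean_space" and f g :: "real \<Rightarrow> real"
  assumes "finite S" and q: "\<And>i. i \<in> S \<Longrightarrow> unimodal (q i)"
    and [measurable]: "f \<in> borel_measurable borel" "g \<in> borel_measurable borel"
    and nn: "\<And>t. 0 \<le> f t" "\<And>t. 0 \<le> g t" and "f 0 = g 0"
    and near: "\<And>t. \<bar>t\<bar> \<le> t0 \<Longrightarrow> g t \<le> f t" and far: "\<And>t. t0 \<le> \<bar>t\<bar> \<Longrightarrow> f t \<le> g t" and "0 \<le> t0"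
    and eq: "(\<integral>\<^sup>+t. f t \<partial>lborel) = (\<integral>\<^sup>+t. g t \<partial>lborel)" and fin: "(\<integral>\<^sup>+t. f t \<partial>lborel) \<noteq> \<infinity>"
  shows "(\<integral>\<^sup>+y. (\<Prod>i\<in>S. q i (y \<bullet> v i)) * g (y \<bullet> v j) \<partial>lborel) \<le>
         (\<integral>\<^sup>+y. (\<Prod>i\<in>S. q i (y \<bullet> v i)) * f (y \<bullet> v j) \<partial>lborel)"
proof (cases "v j = 0")
  case True
  then show ?thesis using \<open>f 0 = g 0\<close> by simp
next
  case False
  define u where "u = v j"
  have u: "u \<noteq> 0" using False by (simp add: u_def)
  have [measurable]: "q i \<in> borel_measurable borel" if "i \<in> S" for i
    using q[OF that] by (simp add: unimodal_def)
  define m where "m t = (\<integral>\<^sup>+y. indicator {-1..1} (y \<bullet> u) *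
    (\<Prod>i\<in>S. q i ((y + ((t - y \<bullet> u) / (u \<bullet> u)) *\<^sub>R u) \<bullet> v i)) \<partial>lborel)" for t
  \<comment> \<open>The slab \<open>K\<close> and the vectors \<open>a i\<close> rewrite
    \<open>m t\<close> as a section integral at height \<open>t\<close>: the point \<open>y\<close>
    shifted along \<open>u\<close> onto the hyperplane \<open>z \<bullet> u = t\<close> depends
    linearly on \<open>(y, t)\<close>, and \<open>a i\<close> represents its inner product with
    \<open>v i\<close>.\<close>
  define K where "K = {z :: 'a \<times> real. z \<bullet> (u, 0) \<in> {-1..1}}"
  define a where "a i = (v i - ((u \<bullet> v i) / (u \<bullet> u)) *\<^sub>R u, (u \<bullet> v i) / (u \<bullet> u))" for i
  have a: "(y + ((t - y \<bullet> u) / (u \<bullet> u)) *\<^sub>R u) \<bullet> v i = (y, t) \<bullet> a i" for y t i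
    using u by (simp add: a_def inner_add_left inner_diff_right field_simps)
  have m_alt: "m t = (\<integral>\<^sup>+y. indicator K (y, t) * (\<Prod>i\<in>S. q i ((y, t) \<bullet> a i)) \<partial>lborel)" for t
    unfolding m_def a by (intro nn_integral_cong) (auto simp: K_def indicator_def)
  have m: "m t \<le> m s" if "\<bar>s\<bar> \<le> \<bar>t\<bar>" for s t
    unfolding m_alt
  proof (rule unimodal_product_section_mono)
    have K: "K = (\<lambda>z. z \<bullet> (u, 0)) -` {-1..1}" by (auto simp: K_def)
    show "K \<in> sets borel" unfolding K_def by measurable
    show "convex K" unfolding K
      by (intro convex_linear_vimage) (simp_all add: bounded_linear.linear bounded_linear_inner_left)
    show "- z \<in> K" if "z \<in> K" for z using that by (auto simp: K_def)
  qed (use assms that in auto)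
  have [measurable]: "m \<in> borel_measurable borel"
    unfolding m_def by measurable
  have "(\<integral>\<^sup>+t. g t * m t \<partial>lborel) \<le> (\<integral>\<^sup>+t. f t * m t \<partial>lborel)"
    by (rule crossing[OF _ _ _ nn m near far \<open>0 \<le> t0\<close> eq fin]) measurable
  moreover have "2 * (\<integral>\<^sup>+y. (\<Prod>i\<in>S. q i (y \<bullet> v i)) * ennreal (h (y \<bullet> v j)) \<partial>lborel) = (\<integral>\<^sup>+t. h t * m t \<partial>lborel)"
    if [measurable]: "h \<in> borel_measurable borel" for h :: "real \<Rightarrow> real"
    using disintegration[of "\<lambda>y. \<Prod>i\<in>S. q i (y \<bullet> v i)" "\<lambda>t. ennreal (h t)" u] u
    unfolding m_def u_def[symmetric] by simp
  ultimately have "2 * (\<integral>\<^sup>+y. (\<Prod>i\<in>S. q i (y \<bullet> v i)) * ennreal (g (y \<bullet> v j)) \<partial>lborel) \<le>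
      2 * (\<integral>\<^sup>+y. (\<Prod>i\<in>S. q i (y \<bullet> v i)) * ennreal (f (y \<bullet> v j)) \<partial>lborel)"
    by simp
  then show ?thesis
    by (simp add: ennreal_mult_le_mult_iff)
qed

text \<open>Shifting along \<open>v j\<close> leaves the other factors unchanged when their vectors
  are orthogonal to it. The slice integral is then constant in \<open>t\<close>, and only the total
  integral of the exchanged factor matters.\<close>

lemma replace_factor_eq:
  fixes v :: "'n \<Rightarrow> 'a::euclidean_space" and f g :: "real \<Rightarrow> real" and q :: "'n \<Rightarrow> real \<Rightarrow> ennreal"
  assumes [measurable]: "\<And>i. i \<in> S \<Longrightarrow> q i \<in> borel_measurable borel"
      "f \<in> borel_measurable borel" "g \<in> borel_measurable borel"
    and orth: "\<And>i. i \<in> S \<Longrightarrow> v j \<bullet> v i = 0" "v j \<noteq> 0"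
    and eq: "(\<integral>\<^sup>+t. f t \<partial>lborel) = (\<integral>\<^sup>+t. g t \<partial>lborel)"
  shows "(\<integral>\<^sup>+y. (\<Prod>i\<in>S. q i (y \<bullet> v i)) * g (y \<bullet> v j) \<partial>lborel) =
         (\<integral>\<^sup>+y. (\<Prod>i\<in>S. q i (y \<bullet> v i)) * f (y \<bullet> v j) \<partial>lborel)"
proof -
  have "2 * (\<integral>\<^sup>+y. (\<Prod>i\<in>S. q i (y \<bullet> v i)) * ennreal (h (y \<bullet> v j)) \<partial>lborel) =
      (\<integral>\<^sup>+t. h t \<partial>lborel) * (\<integral>\<^sup>+y. indicator {-1..1} (y \<bullet> v j) * (\<Prod>i\<in>S. q i (y \<bullet> v i)) \<partial>lborel)"
    if [measurable]: "h \<in> borel_measurable borel" for h :: "real \<Rightarrow> real"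
    using orth by (subst disintegration) (auto simp: inner_add_left nn_integral_multc)
  from this[of g] this[of f] eq
  have "2 * (\<integral>\<^sup>+y. (\<Prod>i\<in>S. q i (y \<bullet> v i)) * ennreal (g (y \<bullet> v j)) \<partial>lborel) =
      2 * (\<integral>\<^sup>+y. (\<Prod>i\<in>S. q i (y \<bullet> v i)) * ennreal (f (y \<bullet> v j)) \<partial>lborel)"
    by simp
  then show ?thesis
    by (simp add: ennreal_mult_cancel_left)
qed

text \<open>The indices in \<open>S\<close> already carry \<open>f\<close>, those in
  \<open>T\<close> still carry \<open>g\<close>. The induction hypothesis is used with the new index
  \<open>j\<close> counted in \<open>T\<close>, and \<open>step\<close> then exchanges the single
  factor at \<open>j\<close>. The relation \<open>R\<close> stays abstract so that one induction
  serves both the inequality and the equality.\<close>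

lemma product_exchange:
  fixes v :: "'n \<Rightarrow> 'a::euclidean_space" and f g :: "real \<Rightarrow> ennreal"
  assumes "finite S" "finite T" "S \<inter> T = {}" "reflp R" "transp R"
    and step: "\<And>j U q. finite U \<Longrightarrow> j \<notin> U \<Longrightarrow> (\<And>i. q i = f \<or> q i = g) \<Longrightarrow>
      R (\<integral>\<^sup>+y. (\<Prod>i\<in>U. q i (y \<bullet> v i)) * g (y \<bullet> v j) \<partial>lborel)
        (\<integral>\<^sup>+y. (\<Prod>i\<in>U. q i (y \<bullet> v i)) * f (y \<bullet> v j) \<partial>lborel)"
  shows "R (\<integral>\<^sup>+y. (\<Prod>i\<in>S \<union> T. g (y \<bullet> v i)) \<partial>lborel)
           (\<integral>\<^sup>+y. (\<Prod>i\<in>S. f (y \<bullet> v i)) * (\<Prod>i\<in>T. g (y \<bullet> v i)) \<partial>lborel)"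
  using assms(1-3)
proof (induction S arbitrary: T rule: finite_induct)
  case empty
  then show ?case using \<open>reflp R\<close> by (simp add: reflpD)
next
  case (insert j S)
  define q where "q i = (if i \<in> S then f else g)" for i
  have ST: "S \<inter> T = {}" "j \<notin> T" "finite T" using insert by auto
  have q: "(\<Prod>i\<in>S \<union> T. q i (y \<bullet> v i)) = (\<Prod>i\<in>S. f (y \<bullet> v i)) * (\<Prod>i\<in>T. g (y \<bullet> v i))" for y
  proof -
    have "(\<Prod>i\<in>T. q i (y \<bullet> v i)) = (\<Prod>i\<in>T. g (y \<bullet> v i))"
      using ST by (intro prod.cong) (auto simp: q_def)
    then show ?thesis
      using ST insert by (subst prod.union_disjoint) (auto simp: q_def)
  qed
  have "R (\<integral>\<^sup>+y. (\<Prod>i\<in>S \<union> insert j T. g (y \<bullet> v i)) \<partial>lborel)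
     (\<integral>\<^sup>+y. (\<Prod>i\<in>S. f (y \<bullet> v i)) * (\<Prod>i\<in>insert j T. g (y \<bullet> v i)) \<partial>lborel)"
    using insert by (intro insert.IH) auto
  also have "(\<integral>\<^sup>+y. (\<Prod>i\<in>S. f (y \<bullet> v i)) * (\<Prod>i\<in>insert j T. g (y \<bullet> v i)) \<partial>lborel) =
      (\<integral>\<^sup>+y. (\<Prod>i\<in>S \<union> T. q i (y \<bullet> v i)) * g (y \<bullet> v j) \<partial>lborel)"
    using ST by (intro nn_integral_cong) (simp add: q mult_ac)
  finally have 1: "R (\<integral>\<^sup>+y. (\<Prod>i\<in>insert j S \<union> T. g (y \<bullet> v i)) \<partial>lborel) \<dots>"
    by simp
  have "R (\<integral>\<^sup>+y. (\<Prod>i\<in>S \<union> T. q i (y \<bullet> v i)) * g (y \<bullet> v j) \<partial>lborel)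
     (\<integral>\<^sup>+y. (\<Prod>i\<in>S \<union> T. q i (y \<bullet> v i)) * f (y \<bullet> v j) \<partial>lborel)"
    using insert ST by (intro step) (auto simp: q_def)
  also have "(\<integral>\<^sup>+y. (\<Prod>i\<in>S \<union> T. q i (y \<bullet> v i)) * f (y \<bullet> v j) \<partial>lborel) =
     (\<integral>\<^sup>+y. (\<Prod>i\<in>insert j S. f (y \<bullet> v i)) * (\<Prod>i\<in>T. g (y \<bullet> v i)) \<partial>lborel)"
    using insert by (intro nn_integral_cong) (simp add: q mult_ac)
  finally show ?case
    using 1 \<open>transp R\<close> by (blast dest: transpD)
qed

text \<open>During the exchange the untouched factors are a mixture of \<open>f\<close> and
  \<open>g\<close>, which is why unimodality is asked of both.\<close>

lemma product_mono:
  fixes v :: "'n::finite \<Rightarrow> 'a::euclidean_space" and f g :: "real \<Rightarrow> real"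
  assumes uni: "unimodal (\<lambda>t. ennreal (f t))" "unimodal (\<lambda>t. ennreal (g t))"
    and meas: "f \<in> borel_measurable borel" "g \<in> borel_measurable borel"
    and nn: "\<And>t. 0 \<le> f t" "\<And>t. 0 \<le> g t" and "f 0 = g 0"
    and cross: "\<And>t. \<bar>t\<bar> \<le> t0 \<Longrightarrow> g t \<le> f t" "\<And>t. t0 \<le> \<bar>t\<bar> \<Longrightarrow> f t \<le> g t" "0 \<le> t0"
    and eq: "(\<integral>\<^sup>+t. f t \<partial>lborel) = (\<integral>\<^sup>+t. g t \<partial>lborel)" and fin: "(\<integral>\<^sup>+t. f t \<partial>lborel) \<noteq> \<infinity>"
  shows "(\<integral>\<^sup>+y. (\<Prod>i\<in>UNIV. ennreal (g (y \<bullet> v i))) \<partial>lborel) \<le> (\<integral>\<^sup>+y. (\<Prod>i\<in>UNIV. ennreal (f (y \<bullet> v i))) \<partial>lborel)"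
proof -
  have "(\<integral>\<^sup>+y. (\<Prod>i\<in>UNIV \<union> {}. ennreal (g (y \<bullet> v i))) \<partial>lborel) \<le>
     (\<integral>\<^sup>+y. (\<Prod>i\<in>UNIV. ennreal (f (y \<bullet> v i))) * (\<Prod>i\<in>{}. ennreal (g (y \<bullet> v i))) \<partial>lborel)"
  proof (rule product_exchange[where R="(\<le>)"])
    fix j :: 'n and U and q :: "'n \<Rightarrow> real \<Rightarrow> ennreal"
    assume "\<And>i. q i = (\<lambda>t. ennreal (f t)) \<or> q i = (\<lambda>t. ennreal (g t))"
    then have "unimodal (q i)" for i using uni by metis
    then show "(\<integral>\<^sup>+y. (\<Prod>i\<in>U. q i (y \<bullet> v i)) * ennreal (g (y \<bullet> v j)) \<partial>lborel) \<le>
      (\<integral>\<^sup>+y. (\<Prod>i\<in>U. q i (y \<bullet> v i)) * ennreal (f (y \<bullet> v j)) \<partial>lborel)"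
      by (intro replace_factor_mono[OF _ _ meas nn \<open>f 0 = g 0\<close> cross eq fin]) auto
  qed auto
  then show ?thesis by simp
qed

lemma product_eq:
  fixes v :: "'n::finite \<Rightarrow> 'a::euclidean_space" and f g :: "real \<Rightarrow> real"
  assumes meas[measurable]: "f \<in> borel_measurable borel" "g \<in> borel_measurable borel"
    and orth: "\<And>i j. i \<noteq> j \<Longrightarrow> v i \<bullet> v j = 0" "\<And>i. v i \<noteq> 0"
    and eq: "(\<integral>\<^sup>+t. f t \<partial>lborel) = (\<integral>\<^sup>+t. g t \<partial>lborel)"
  shows "(\<integral>\<^sup>+y. (\<Prod>i\<in>UNIV. ennreal (g (y \<bullet> v i))) \<partial>lborel) = (\<integral>\<^sup>+y. (\<Prod>i\<in>UNIV. ennreal (f (y \<bullet> v i))) \<partial>lborel)"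
proof -
  have "(\<integral>\<^sup>+y. (\<Prod>i\<in>UNIV \<union> {}. ennreal (g (y \<bullet> v i))) \<partial>lborel) =
     (\<integral>\<^sup>+y. (\<Prod>i\<in>UNIV. ennreal (f (y \<bullet> v i))) * (\<Prod>i\<in>{}. ennreal (g (y \<bullet> v i))) \<partial>lborel)"
  proof (rule product_exchange[where R="(=)"])
    fix j :: 'n and U and q :: "'n \<Rightarrow> real \<Rightarrow> ennreal"
    assume "\<And>i. q i = (\<lambda>t. ennreal (f t)) \<or> q i = (\<lambda>t. ennreal (g t))" and "j \<notin> U"
    moreover have "(\<lambda>t. ennreal (f t)) \<in> borel_measurable borel" "(\<lambda>t. ennreal (g t)) \<in> borel_measurable borel"
      by measurable
    ultimately have "q i \<in> borel_measurable borel" for i by metis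
    then show "(\<integral>\<^sup>+y. (\<Prod>i\<in>U. q i (y \<bullet> v i)) * ennreal (g (y \<bullet> v j)) \<partial>lborel) =
      (\<integral>\<^sup>+y. (\<Prod>i\<in>U. q i (y \<bullet> v i)) * ennreal (f (y \<bullet> v j)) \<partial>lborel)"
      using \<open>j \<notin> U\<close> by (intro replace_factor_eq meas orth eq) auto
  qed (auto simp: transp_def reflp_def)
  then show ?thesis by simp
qed

section \<open>Laplace transforms\<close>

text \<open>A fixed reference law: the moments of \<open>G\<close> and of \<open>H\<close>, given on
  unrelated probability spaces, are both rewritten as integrals against it.\<close>

definition std_gauss :: "'a::euclidean_space measure" where
  "std_gauss = density lborel (\<lambda>y. ennreal (\<Prod>b\<in>Basis. std_normal_density (y \<bullet> b)))"

lemma sets_std_gauss[measurable_cong, simp]: "sets std_gauss = sets borel"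
  by (simp add: std_gauss_def)

lemma space_std_gauss[simp]: "space std_gauss = UNIV"
  by (simp add: std_gauss_def)

lemma prod_std_normal_density:
  fixes y :: "'a::euclidean_space"
  shows "(\<Prod>b\<in>Basis. std_normal_density (y \<bullet> b)) = (1 / sqrt (2 * pi)) ^ DIM('a) * exp (- (norm y)\<^sup>2 / 2)"
proof -
  have "(norm y)\<^sup>2 = (\<Sum>b\<in>Basis. (y \<bullet> b)\<^sup>2)"
    unfolding power2_norm_eq_inner by (subst euclidean_inner) (simp add: power2_eq_square)
  then have "(\<Sum>b\<in>Basis. - (y \<bullet> b)\<^sup>2 / 2) = - (norm y)\<^sup>2 / 2"
    by (simp add: sum_negf sum_divide_distrib)
  then have "(\<Prod>b\<in>Basis. exp (- (y \<bullet> b)\<^sup>2 / 2)) = exp (- (norm y)\<^sup>2 / 2)"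
    by (subst exp_sum[symmetric]) auto
  then show ?thesis
    unfolding std_normal_density_def prod.distrib by simp
qed

lemma nn_integral_std_gauss:
  fixes F :: "'a::euclidean_space \<Rightarrow> ennreal"
  assumes [measurable]: "F \<in> borel_measurable borel"
  shows "(\<integral>\<^sup>+y. F y \<partial>std_gauss) =
    ennreal ((1 / sqrt (2 * pi)) ^ DIM('a)) * (\<integral>\<^sup>+y. F y * ennreal (exp (- (norm y)\<^sup>2 / 2)) \<partial>lborel)"
  unfolding std_gauss_def prod_std_normal_density
  by (subst nn_integral_density) (auto simp: nn_integral_cmult[symmetric] ennreal_mult mult_ac)

text \<open>When the numbers \<open>y \<bullet> v i\<close> are the coordinates of a vector, this is
  the \<open>p\<close>-th power of its \<open>lp_norm\<close>.\<close>

definition power_sum :: "real \<Rightarrow> ('n::finite \<Rightarrow> 'a::euclidean_space) \<Rightarrow> 'a \<Rightarrow> real" where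
  "power_sum p v y = (\<Sum>i\<in>UNIV. \<bar>y \<bullet> v i\<bar> powr p)"

lemma power_sum_nonneg: "0 \<le> power_sum p v y"
  by (simp add: power_sum_def sum_nonneg)

lemma borel_measurable_power_sum[measurable]: "power_sum p v \<in> borel_measurable borel"
  unfolding power_sum_def by measurable

text \<open>One coordinate's share of the Laplace kernel and of the Gaussian weight. The normalising
  constant is left out, so that the value at 0 is 1 and agrees with that of
  \<open>exp (- \<kappa> * t\<^sup>2 / 2)\<close>.\<close>

definition tilt :: "real \<Rightarrow> real \<Rightarrow> real \<Rightarrow> real" where
  "tilt \<tau> p t = exp (- \<tau> * \<bar>t\<bar> powr p - t\<^sup>2 / 2)"

lemma borel_measurable_tilt[measurable]: "tilt \<tau> p \<in> borel_measurable borel"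
  unfolding tilt_def by measurable

text \<open>The hypothesis on \<open>v\<close> distributes the Gaussian weight
  \<open>exp (- (norm y)\<^sup>2 / 2)\<close> over the directions \<open>v i\<close>, just as the
  Laplace kernel splits by definition of \<open>power_sum\<close>.\<close>

lemma Laplace_std_gauss:
  fixes v :: "'n::finite \<Rightarrow> 'a::euclidean_space"
  assumes "\<And>y. (\<Sum>i\<in>UNIV. (y \<bullet> v i)\<^sup>2) = (norm y)\<^sup>2"
  shows "(\<integral>\<^sup>+y. ennreal (exp (- \<tau> * power_sum p v y)) \<partial>std_gauss) =
    ennreal ((1 / sqrt (2 * pi)) ^ DIM('a)) * (\<integral>\<^sup>+y. (\<Prod>i\<in>UNIV. ennreal (tilt \<tau> p (y \<bullet> v i))) \<partial>lborel)"
proof -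
  have "(\<Prod>i\<in>UNIV. ennreal (tilt \<tau> p (y \<bullet> v i))) =
     ennreal (exp (- \<tau> * power_sum p v y)) * ennreal (exp (- (norm y)\<^sup>2 / 2))" for y
  proof -
    have "(\<Sum>i\<in>UNIV. - \<tau> * \<bar>y \<bullet> v i\<bar> powr p - (y \<bullet> v i)\<^sup>2 / 2) = - \<tau> * power_sum p v y + - (norm y)\<^sup>2 / 2"
      unfolding assms[symmetric] power_sum_def
      by (simp add: sum_subtractf sum_distrib_left sum_divide_distrib sum_negf)
    then show ?thesis
      by (simp add: tilt_def prod_ennreal exp_sum[symmetric] exp_add[symmetric] ennreal_mult[symmetric])
  qed
  then show ?thesis
    by (subst nn_integral_std_gauss) auto
qed

section \<open>One-dimensional integrals and the choice of the matching Gaussian\<close>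

lemma nn_integral_std_normal_density: "(\<integral>\<^sup>+x. ennreal (std_normal_density x) \<partial>lborel) = 1"
proof -
  interpret prob_space "density lborel (\<lambda>x. ennreal (std_normal_density x))"
    by (rule prob_space_normal_density) simp
  show ?thesis
    using emeasure_space_1 by (simp add: emeasure_density)
qed

lemma Gaussian_integral_finite: "(\<integral>\<^sup>+t. ennreal (exp (- t\<^sup>2 / 2)) \<partial>lborel) \<noteq> \<infinity>"
proof -
  have "(\<integral>\<^sup>+t. ennreal (exp (- t\<^sup>2 / 2)) \<partial>lborel) = (\<integral>\<^sup>+t. ennreal (sqrt (2 * pi)) * ennreal (std_normal_density t) \<partial>lborel)"
    by (simp add: std_normal_density_def ennreal_mult[symmetric])
  also have "\<dots> = ennreal (sqrt (2 * pi)) * (\<integral>\<^sup>+t. ennreal (std_normal_density t) \<partial>lborel)"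
    by (rule nn_integral_cmult) simp
  finally show ?thesis by (simp add: nn_integral_std_normal_density)
qed

lemma tilt_integral_finite:
  assumes "0 < \<tau>" shows "(\<integral>\<^sup>+t. ennreal (tilt \<tau> p t) \<partial>lborel) \<noteq> \<infinity>"
proof -
  have "(\<integral>\<^sup>+t. ennreal (tilt \<tau> p t) \<partial>lborel) \<le> (\<integral>\<^sup>+t. ennreal (exp (- t\<^sup>2 / 2)) \<partial>lborel)"
    using assms by (intro nn_integral_mono ennreal_leI) (simp add: tilt_def)
  then show ?thesis using Gaussian_integral_finite by (auto simp: top_unique)
qed

lemma nn_integral_pos:
  fixes f :: "real \<Rightarrow> real"
  assumes [measurable]: "f \<in> borel_measurable borel" and "\<And>t. 0 < f t"
  shows "(\<integral>\<^sup>+t. ennreal (f t) \<partial>lborel) \<noteq> 0"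
proof
  assume "(\<integral>\<^sup>+t. ennreal (f t) \<partial>lborel) = 0"
  then have "AE t in lborel. ennreal (f t) = 0"
    by (subst (asm) nn_integral_0_iff_AE) auto
  moreover have "ennreal (f t) \<noteq> 0" for t
    using assms(2)[of t] by simp
  ultimately have "AE t in lborel :: real measure. False"
    by simp
  then show False by (simp add: AE_iff_null null_sets_def)
qed

text \<open>By scaling, the integral of \<open>exp (- c\<^sup>2 * t\<^sup>2 / 2)\<close> is
  \<open>J / c\<close> with \<open>J\<close> the integral for \<open>c = 1\<close>. Hence
  \<open>c = J / I\<close> and \<open>\<kappa> = c\<^sup>2\<close> produce the prescribed integral
  \<open>I\<close>.\<close>

lemma matching_Gaussian:
  assumes "0 < \<tau>"
  obtains \<kappa> where "0 < \<kappa>" "(\<integral>\<^sup>+t. ennreal (exp (- \<kappa> * t\<^sup>2 / 2)) \<partial>lborel) = (\<integral>\<^sup>+t. ennreal (tilt \<tau> p t) \<partial>lborel)"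
proof -
  obtain I where I: "(\<integral>\<^sup>+t. ennreal (tilt \<tau> p t) \<partial>lborel) = ennreal I" "0 < I"
    using tilt_integral_finite[OF assms, of p] nn_integral_pos[of "tilt \<tau> p"]
    by (cases "\<integral>\<^sup>+t. ennreal (tilt \<tau> p t) \<partial>lborel") (auto simp: tilt_def less_le)
  obtain J where J: "(\<integral>\<^sup>+t. ennreal (exp (- t\<^sup>2 / 2)) \<partial>lborel) = ennreal J" "0 < J"
    using Gaussian_integral_finite nn_integral_pos[of "\<lambda>t. exp (- t\<^sup>2 / 2)"]
    by (cases "\<integral>\<^sup>+t. ennreal (exp (- t\<^sup>2 / 2)) \<partial>lborel") (auto simp: less_le)
  define c where "c = J / I"
  have c: "0 < c" using I J by (simp add: c_def)
  have "ennreal J = ennreal \<bar>c\<bar> * (\<integral>\<^sup>+t. ennreal (exp (- (0 + c * t)\<^sup>2 / 2)) \<partial>lborel)"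
    unfolding J(1)[symmetric] using c by (intro nn_integral_real_affine) auto
  moreover have "ennreal J = ennreal c * ennreal I"
    using I J by (simp add: ennreal_mult[symmetric] c_def)
  ultimately have "ennreal c * ennreal I = ennreal c * (\<integral>\<^sup>+t. ennreal (exp (- (c\<^sup>2) * t\<^sup>2 / 2)) \<partial>lborel)"
    using c by (simp add: power_mult_distrib)
  then have "ennreal I = (\<integral>\<^sup>+t. ennreal (exp (- (c\<^sup>2) * t\<^sup>2 / 2)) \<partial>lborel)"
    using c by (subst (asm) ennreal_mult_cancel_left) auto
  then show ?thesis
    using c I by (intro that[of "c\<^sup>2"]) auto
qed

lemma unimodal_tilt:
  assumes "0 < \<tau>" "0 < p" shows "unimodal (\<lambda>t. ennreal (tilt \<tau> p t))"
  unfolding unimodal_def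
proof (intro conjI allI impI ennreal_leI)
  fix s t :: real assume st: "\<bar>s\<bar> \<le> \<bar>t\<bar>"
  have "\<tau> * \<bar>s\<bar> powr p \<le> \<tau> * \<bar>t\<bar> powr p"
    using st assms by (intro mult_left_mono powr_mono2) auto
  moreover have "s\<^sup>2 \<le> t\<^sup>2" using st by (simp add: abs_le_square_iff)
  ultimately show "tilt \<tau> p t \<le> tilt \<tau> p s"
    by (simp add: tilt_def)
qed measurable

lemma unimodal_Gaussian:
  assumes "0 < \<kappa>" shows "unimodal (\<lambda>t. ennreal (exp (- \<kappa> * t\<^sup>2 / 2)))"
  using assms by (auto simp: unimodal_def abs_le_square_iff intro!: ennreal_leI)

lemma powr_le_threshold:
  fixes t :: real
  assumes "0 < r" "0 < c"
  shows "\<bar>t\<bar> \<le> c powr (1 / r) \<Longrightarrow> \<bar>t\<bar> powr r \<le> c" "c powr (1 / r) \<le> \<bar>t\<bar> \<Longrightarrow> c \<le> \<bar>t\<bar> powr r"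
proof -
  have c: "(c powr (1 / r)) powr r = c" using assms by (simp add: powr_powr)
  show "\<bar>t\<bar> \<le> c powr (1 / r) \<Longrightarrow> \<bar>t\<bar> powr r \<le> c"
    using powr_mono2[of r "\<bar>t\<bar>" "c powr (1 / r)"] assms c by simp
  show "c powr (1 / r) \<le> \<bar>t\<bar> \<Longrightarrow> c \<le> \<bar>t\<bar> powr r"
    using powr_mono2[of r "c powr (1 / r)" "\<bar>t\<bar>"] assms c by simp
qed

lemma abs_powr_split:
  fixes t :: real
  assumes "a + b = c" "0 < a" "0 < b" "0 < c" shows "\<bar>t\<bar> powr c = \<bar>t\<bar> powr a * \<bar>t\<bar> powr b"
  using assms by (auto simp flip: powr_add)

lemma abs_powr_2: "\<bar>t\<bar> powr 2 = (t\<^sup>2 :: real)"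
  by (cases "t = 0") auto

text \<open>Both transforms are compared with the same value \<open>C * P\<close>, obtained by
  putting the matching Gaussian \<open>g\<close> for every factor; \<open>P\<close> is common
  because the product of the \<open>g\<close> factors depends on \<open>norm y\<close> only.
  Orthogonality of \<open>w\<close> makes the exchange an equality for \<open>L'\<close>, while for
  \<open>L\<close> it is an inequality whose direction follows from the sign change of
  \<open>tilt \<tau> p - g\<close>.\<close>

lemma Laplace_comparison:
  fixes v :: "'n::finite \<Rightarrow> 'a::euclidean_space" and w :: "'k::finite \<Rightarrow> 'a"
  assumes v: "\<And>y. (\<Sum>i\<in>UNIV. (y \<bullet> v i)\<^sup>2) = (norm y)\<^sup>2" and w: "\<And>y. (\<Sum>i\<in>UNIV. (y \<bullet> w i)\<^sup>2) = (norm y)\<^sup>2"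
    and orth: "\<And>i j. i \<noteq> j \<Longrightarrow> w i \<bullet> w j = 0" "\<And>i. w i \<noteq> 0" and "0 < \<tau>" "0 < p"
  defines "L \<equiv> \<integral>\<^sup>+y. ennreal (exp (- \<tau> * power_sum p v y)) \<partial>std_gauss"
    and "L' \<equiv> \<integral>\<^sup>+y. ennreal (exp (- \<tau> * power_sum p w y)) \<partial>std_gauss"
  shows "2 < p \<Longrightarrow> L' \<le> L" "p < 2 \<Longrightarrow> L \<le> L'"
proof -
  obtain \<kappa> where \<kappa>: "0 < \<kappa>" and eq: "(\<integral>\<^sup>+t. ennreal (exp (- \<kappa> * t\<^sup>2 / 2)) \<partial>lborel) = (\<integral>\<^sup>+t. ennreal (tilt \<tau> p t) \<partial>lborel)"
    using matching_Gaussian[OF \<open>0 < \<tau>\<close>] .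
  define g where "g t = exp (- \<kappa> * t\<^sup>2 / 2)" for t :: real
  have [measurable]: "g \<in> borel_measurable borel" unfolding g_def by measurable
  have eqg: "(\<integral>\<^sup>+t. ennreal (g t) \<partial>lborel) = (\<integral>\<^sup>+t. ennreal (tilt \<tau> p t) \<partial>lborel)"
    using eq by (simp add: g_def)
  have fin: "(\<integral>\<^sup>+t. ennreal (g t) \<partial>lborel) \<noteq> \<infinity>" "(\<integral>\<^sup>+t. ennreal (tilt \<tau> p t) \<partial>lborel) \<noteq> \<infinity>"
    using tilt_integral_finite[OF \<open>0 < \<tau>\<close>] by (simp_all add: eqg)
  have uni: "unimodal (\<lambda>t. ennreal (g t))" "unimodal (\<lambda>t. ennreal (tilt \<tau> p t))"
    using unimodal_Gaussian[OF \<kappa>] unimodal_tilt assms by (auto simp: g_def)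
  have nn: "0 \<le> g t" "0 \<le> tilt \<tau> p t" for t by (auto simp: g_def tilt_def)
  have at0: "g 0 = tilt \<tau> p 0" using assms by (simp add: g_def tilt_def)
  have prod_g: "(\<Prod>i\<in>UNIV. ennreal (g (y \<bullet> u i))) = ennreal (exp (- \<kappa> * (norm y)\<^sup>2 / 2))"
    if "\<And>y. (\<Sum>i\<in>UNIV. (y \<bullet> u i)\<^sup>2) = (norm y)\<^sup>2" for u :: "'i::finite \<Rightarrow> 'a" and y
  proof -
    have "(\<Sum>i\<in>UNIV. - \<kappa> * (y \<bullet> u i)\<^sup>2 / 2) = - \<kappa> * (norm y)\<^sup>2 / 2"
      unfolding that[symmetric] by (simp add: sum_distrib_left sum_divide_distrib sum_negf)
    then show ?thesis by (simp add: g_def prod_ennreal exp_sum[symmetric])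
  qed
  define P where "P = (\<integral>\<^sup>+y. ennreal (exp (- \<kappa> * (norm (y::'a))\<^sup>2 / 2)) \<partial>lborel)"
  have Pv: "(\<integral>\<^sup>+y. (\<Prod>i\<in>UNIV. ennreal (g (y \<bullet> v i))) \<partial>lborel) = P"
    and Pw: "(\<integral>\<^sup>+y. (\<Prod>i\<in>UNIV. ennreal (g (y \<bullet> w i))) \<partial>lborel) = P"
    by (simp_all add: prod_g v w P_def)
  define C where "C = ennreal ((1 / sqrt (2 * pi)) ^ DIM('a))"
  have L': "L' = C * P"
    unfolding L'_def Laplace_std_gauss[OF w] C_def Pw[symmetric]
    by (subst product_eq[OF _ _ orth eqg[symmetric]]) auto
  have L: "L = C * (\<integral>\<^sup>+y. (\<Prod>i\<in>UNIV. ennreal (tilt \<tau> p (y \<bullet> v i))) \<partial>lborel)"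
    unfolding L_def Laplace_std_gauss[OF v] C_def ..
  \<comment> \<open>Comparing exponents of \<open>g\<close> and \<open>tilt\<close> reduces
    everything to \<open>\<tau> * \<bar>t\<bar> powr p\<close> against
    \<open>a * t\<^sup>2\<close>.\<close>
  define a where "a = (\<kappa> - 1) / 2"
  have compare: "g t \<le> tilt \<tau> p t \<longleftrightarrow> \<tau> * \<bar>t\<bar> powr p \<le> a * t\<^sup>2" "tilt \<tau> p t \<le> g t \<longleftrightarrow> a * t\<^sup>2 \<le> \<tau> * \<bar>t\<bar> powr p" for t
    by (auto simp: g_def tilt_def a_def field_simps)
  \<comment> \<open>For \<open>a \<le> 0\<close> there is no crossing at a positive point. The case
    is not excluded but handled directly: for \<open>p > 2\<close> with \<open>t0 = 0\<close>, for
    \<open>p < 2\<close> by comparing the products pointwise.\<close>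
  have neg: "tilt \<tau> p t \<le> g t" if "a \<le> 0" for t
  proof -
    have "a * t\<^sup>2 \<le> 0" using that by (simp add: mult_nonpos_nonneg)
    also have "0 \<le> \<tau> * \<bar>t\<bar> powr p" using assms by simp
    finally show ?thesis using compare by simp
  qed
  show "L' \<le> L" if "2 < p"
  proof -
    have split: "\<bar>t\<bar> powr p = \<bar>t\<bar> powr (p - 2) * t\<^sup>2" for t
      using abs_powr_split[of "p - 2" 2 p t] that abs_powr_2 by simp
    \<comment> \<open>The positive solution of \<open>\<tau> * t0 powr p = a * t0\<^sup>2\<close>,
      if there is one.\<close>
    define t0 where "t0 = (if a \<le> 0 then 0 else (a / \<tau>) powr (1 / (p - 2)))"
    have "P \<le> (\<integral>\<^sup>+y. (\<Prod>i\<in>UNIV. ennreal (tilt \<tau> p (y \<bullet> v i))) \<partial>lborel)"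
      unfolding Pv[symmetric]
    proof (rule product_mono[OF uni(2,1) _ _ nn(2,1) at0[symmetric] _ _ _ eqg[symmetric] fin(2), where ?t0.0=t0])
      show "0 \<le> t0" by (simp add: t0_def)
      show "g t \<le> tilt \<tau> p t" if "\<bar>t\<bar> \<le> t0" for t
      proof (cases "a \<le> 0")
        case True
        then show ?thesis using that at0 by (simp add: t0_def)
      next
        case False
        then have "\<bar>t\<bar> powr (p - 2) \<le> a / \<tau>"
          using that \<open>2 < p\<close> \<open>0 < \<tau>\<close> by (intro powr_le_threshold) (auto simp: t0_def)
        then have "\<tau> * \<bar>t\<bar> powr (p - 2) * t\<^sup>2 \<le> a * t\<^sup>2"
          using \<open>0 < \<tau>\<close> by (intro mult_right_mono) (auto simp: field_simps)
        then show ?thesis unfolding compare split by (simp add: mult.assoc)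
      qed
      show "tilt \<tau> p t \<le> g t" if "t0 \<le> \<bar>t\<bar>" for t
      proof (cases "a \<le> 0")
        case False
        then have "a / \<tau> \<le> \<bar>t\<bar> powr (p - 2)"
          using that \<open>2 < p\<close> \<open>0 < \<tau>\<close> by (intro powr_le_threshold) (auto simp: t0_def)
        then have "a * t\<^sup>2 \<le> \<tau> * \<bar>t\<bar> powr (p - 2) * t\<^sup>2"
          using \<open>0 < \<tau>\<close> by (intro mult_right_mono) (auto simp: field_simps)
        then show ?thesis unfolding compare split by (simp add: mult.assoc)
      qed (rule neg)
    qed auto
    then show ?thesis unfolding L L' by (intro mult_left_mono) auto
  qed
  show "L \<le> L'" if "p < 2"
  proof -
    have split: "t\<^sup>2 = \<bar>t\<bar> powr p * \<bar>t\<bar> powr (2 - p)" for t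
      using abs_powr_split[of p "2 - p" 2 t] that abs_powr_2 \<open>0 < p\<close> by simp
    have "(\<integral>\<^sup>+y. (\<Prod>i\<in>UNIV. ennreal (tilt \<tau> p (y \<bullet> v i))) \<partial>lborel) \<le> P"
      unfolding Pv[symmetric]
    proof (cases "a \<le> 0")
      case True
      then show "(\<integral>\<^sup>+y. (\<Prod>i\<in>UNIV. ennreal (tilt \<tau> p (y \<bullet> v i))) \<partial>lborel) \<le>
          (\<integral>\<^sup>+y. (\<Prod>i\<in>UNIV. ennreal (g (y \<bullet> v i))) \<partial>lborel)"
        by (auto simp: prod_ennreal nn intro!: nn_integral_mono ennreal_leI prod_mono neg)
    next
      case False
      show "(\<integral>\<^sup>+y. (\<Prod>i\<in>UNIV. ennreal (tilt \<tau> p (y \<bullet> v i))) \<partial>lborel) \<le>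
          (\<integral>\<^sup>+y. (\<Prod>i\<in>UNIV. ennreal (g (y \<bullet> v i))) \<partial>lborel)"
      \<comment> \<open>For \<open>p < 2\<close> the crossing point solves
        \<open>t0 powr (2 - p) = \<tau> / a\<close>. The roles are interchanged: now
        \<open>g\<close> is the larger function near 0.\<close>
      proof (rule product_mono[OF uni _ _ nn at0 _ _ _ eqg fin(1), where ?t0.0="(\<tau> / a) powr (1 / (2 - p))"])
        show "tilt \<tau> p t \<le> g t" if "\<bar>t\<bar> \<le> (\<tau> / a) powr (1 / (2 - p))" for t
        proof -
          have "\<bar>t\<bar> powr (2 - p) \<le> \<tau> / a"
            using that \<open>p < 2\<close> \<open>0 < \<tau>\<close> False by (intro powr_le_threshold) auto
          then have "\<bar>t\<bar> powr p * (a * \<bar>t\<bar> powr (2 - p)) \<le> \<bar>t\<bar> powr p * \<tau>"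
            using False by (intro mult_left_mono) (auto simp: field_simps)
          then show ?thesis unfolding compare split by (simp add: mult_ac)
        qed
        show "g t \<le> tilt \<tau> p t" if "(\<tau> / a) powr (1 / (2 - p)) \<le> \<bar>t\<bar>" for t
        proof -
          have "\<tau> / a \<le> \<bar>t\<bar> powr (2 - p)"
            using that \<open>p < 2\<close> \<open>0 < \<tau>\<close> False by (intro powr_le_threshold) auto
          then have "\<bar>t\<bar> powr p * \<tau> \<le> \<bar>t\<bar> powr p * (a * \<bar>t\<bar> powr (2 - p))"
            using False by (intro mult_left_mono) (auto simp: field_simps)
          then show ?thesis unfolding compare split by (simp add: mult_ac)
        qed
      qed auto
    qed
    then show ?thesis unfolding L L' by (intro mult_left_mono) auto
  qed
qed

section \<open>Moments from Laplace transforms\<close>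

text \<open>The substitution of \<open>x * t\<close> for \<open>t\<close> in the Mellin integral of
  \<open>h\<close>. The exponent \<open>a\<close> may have either sign, so both negative and
  positive powers of \<open>x\<close> arise as mixtures of \<open>h (t * x)\<close>.\<close>

lemma Mellin_scaling:
  fixes h :: "real \<Rightarrow> real"
  assumes [measurable]: "h \<in> borel_measurable borel" and h: "\<And>u. 0 \<le> u \<Longrightarrow> 0 \<le> h u" and x: "0 < x"
  shows "(\<integral>\<^sup>+t. ennreal (h (t * x) * t powr (a - 1)) * indicator {0<..} t \<partial>lborel) =
    ennreal (x powr (- a)) * (\<integral>\<^sup>+t. ennreal (h t * t powr (a - 1)) * indicator {0<..} t \<partial>lborel)"
    (is "?I = _ * ?C")
proof -
  have "?C = ennreal \<bar>x\<bar> * (\<integral>\<^sup>+t. ennreal (h (0 + x * t) * (0 + x * t) powr (a - 1)) * indicator {0<..} (0 + x * t) \<partial>lborel)"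
    using x by (intro nn_integral_real_affine) auto
  also have "\<dots> = (\<integral>\<^sup>+t. ennreal (x powr a) * (ennreal (h (t * x) * t powr (a - 1)) * indicator {0<..} t) \<partial>lborel)"
  proof (subst nn_integral_cmult[symmetric], simp, intro nn_integral_cong)
    fix t :: real
    show "ennreal \<bar>x\<bar> * (ennreal (h (0 + x * t) * (0 + x * t) powr (a - 1)) * indicator {0<..} (0 + x * t)) =
      ennreal (x powr a) * (ennreal (h (t * x) * t powr (a - 1)) * indicator {0<..} t)"
    proof (cases "0 < t")
      case True
      have "x * x powr (a - 1) = x powr a"
        using x powr_mult_base[of x "a - 1"] by simp
      then show ?thesis
        using x True h[of "x * t"] by (simp add: powr_mult ennreal_mult[symmetric] mult_ac)
    qed (use x in \<open>auto simp: zero_less_mult_iff\<close>)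
  qed
  also have "\<dots> = ennreal (x powr a) * ?I"
    by (rule nn_integral_cmult) simp
  finally have "ennreal (x powr (- a)) * ?C = ennreal (x powr (- a) * x powr a) * ?I"
    by (simp add: ennreal_mult mult.assoc)
  also have "x powr (- a) * x powr a = 1"
    using x by (simp flip: powr_add)
  finally show ?thesis by simp
qed

text \<open>Integrating the hypothesis against \<open>t powr (a - 1)\<close> and exchanging
  integrals gives, by \<open>Mellin_scaling\<close>, the two moments multiplied by the Mellin
  constant \<open>C\<close>, which cancels because it is positive and finite.\<close>

lemma Mellin_comparison:
  fixes h :: "real \<Rightarrow> real"
  assumes "sigma_finite_measure P" and [measurable]: "h \<in> borel_measurable borel" "X \<in> borel_measurable P" "Y \<in> borel_measurable P"
    and h: "\<And>u. 0 \<le> u \<Longrightarrow> 0 \<le> h u"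
    and C: "(\<integral>\<^sup>+t. ennreal (h t * t powr (a - 1)) * indicator {0<..} t \<partial>lborel) = ennreal C" "0 < C"
    and pos: "AE y in P. 0 < X y" "AE y in P. 0 < Y y"
    and le: "\<And>t. 0 < t \<Longrightarrow> (\<integral>\<^sup>+y. ennreal (h (t * X y)) \<partial>P) \<le> (\<integral>\<^sup>+y. ennreal (h (t * Y y)) \<partial>P)"
  shows "(\<integral>\<^sup>+y. ennreal (X y powr (- a)) \<partial>P) \<le> (\<integral>\<^sup>+y. ennreal (Y y powr (- a)) \<partial>P)"
proof -
  interpret sigma_finite_measure P by fact
  interpret pair_sigma_finite P lborel ..
  have eq: "ennreal C * (\<integral>\<^sup>+y. ennreal (Z y powr (- a)) \<partial>P) =
     (\<integral>\<^sup>+t. (\<integral>\<^sup>+y. ennreal (h (t * Z y)) \<partial>P) * (ennreal (t powr (a - 1)) * indicator {0<..} t) \<partial>lborel)"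
    if [measurable]: "Z \<in> borel_measurable P" and Z: "AE y in P. 0 < Z y" for Z
  proof -
    have "ennreal C * (\<integral>\<^sup>+y. ennreal (Z y powr (- a)) \<partial>P) = (\<integral>\<^sup>+y. ennreal (Z y powr (- a)) * ennreal C \<partial>P)"
      by (subst nn_integral_multc) (auto simp: mult.commute)
    also have "\<dots> = (\<integral>\<^sup>+y. \<integral>\<^sup>+t. ennreal (h (t * Z y) * t powr (a - 1)) * indicator {0<..} t \<partial>lborel \<partial>P)"
      using Z by (intro nn_integral_cong_AE, eventually_elim) (simp add: Mellin_scaling h C)
    also have "\<dots> = (\<integral>\<^sup>+t. \<integral>\<^sup>+y. ennreal (h (t * Z y) * t powr (a - 1)) * indicator {0<..} t \<partial>P \<partial>lborel)"
      by (rule Fubini'[symmetric]) measurable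
    also have "\<dots> = (\<integral>\<^sup>+t. \<integral>\<^sup>+y. ennreal (h (t * Z y)) * (ennreal (t powr (a - 1)) * indicator {0<..} t) \<partial>P \<partial>lborel)"
    proof (intro nn_integral_cong)
      fix t :: real and y
      show "ennreal (h (t * Z y) * t powr (a - 1)) * indicator {0<..} t =
        ennreal (h (t * Z y)) * (ennreal (t powr (a - 1)) * indicator {0<..} t)"
        by (simp add: ennreal_mult'' mult.assoc)
    qed
    also have "\<dots> = (\<integral>\<^sup>+t. (\<integral>\<^sup>+y. ennreal (h (t * Z y)) \<partial>P) * (ennreal (t powr (a - 1)) * indicator {0<..} t) \<partial>lborel)"
      by (intro nn_integral_cong nn_integral_multc) measurable
    finally show ?thesis .
  qed
  have "ennreal C * (\<integral>\<^sup>+y. ennreal (X y powr (- a)) \<partial>P) \<le> ennreal C * (\<integral>\<^sup>+y. ennreal (Y y powr (- a)) \<partial>P)"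
    unfolding eq[OF assms(3) pos(1)] eq[OF assms(4) pos(2)]
    using le by (intro nn_integral_mono) (auto intro!: mult_right_mono split: split_indicator)
  then show ?thesis
    using C(2) by (simp add: ennreal_mult_le_mult_iff)
qed

lemma Mellin_constant_exp:
  assumes "0 < a"
  obtains C where "(\<integral>\<^sup>+t. ennreal (exp (- t) * t powr (a - 1)) * indicator {0<..} t \<partial>lborel) = ennreal C" "0 < C"
proof
  show "(\<integral>\<^sup>+t. ennreal (exp (- t) * t powr (a - 1)) * indicator {0<..} t \<partial>lborel) = ennreal (Gamma a)"
    unfolding Gamma_conv_nn_integral_real[OF assms]
    by (intro nn_integral_cong) (auto simp: exp_minus field_simps split: split_indicator)
qed (use assms in \<open>simp add: Gamma_real_pos\<close>)

text \<open>On \<open>(0, 1]\<close> the bound \<open>1 - exp (- t) \<le> t\<close> leaves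
  \<open>t powr (- s)\<close>, integrable since \<open>s < 1\<close>; beyond 1 the bound
  \<open>1 - exp (- t) \<le> 1\<close> leaves \<open>t powr (- s - 1)\<close>, integrable since
  \<open>s > 0\<close>. Positivity of the integrand on \<open>(0, 1)\<close> excludes the value
  0.\<close>

lemma Mellin_constant_one_minus_exp:
  assumes s: "0 < s" "s < 1"
  obtains C where "(\<integral>\<^sup>+t. ennreal ((1 - exp (- t)) * t powr (- s - 1)) * indicator {0<..} t \<partial>lborel) = ennreal C" "0 < C"
proof -
  let ?I = "\<integral>\<^sup>+t. ennreal ((1 - exp (- t)) * t powr (- s - 1)) * indicator {0<..} t \<partial>lborel"
  have "?I \<le> (\<integral>\<^sup>+t. ennreal (indicator {0..1} t * t powr (- s)) + ennreal (indicator {1..} t * t powr (- s - 1)) \<partial>lborel)"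
  proof (rule nn_integral_mono)
    fix t :: real
    consider "t \<le> 0" | "0 < t" "t \<le> 1" | "1 < t" by linarith
    then show "ennreal ((1 - exp (- t)) * t powr (- s - 1)) * indicator {0<..} t \<le>
      ennreal (indicator {0..1} t * t powr (- s)) + ennreal (indicator {1..} t * t powr (- s - 1))"
    proof cases
      case 2
      have "(1 - exp (- t)) * t powr (- s - 1) \<le> t * t powr (- s - 1)"
        using exp_ge_add_one_self[of "- t"] by (intro mult_right_mono) auto
      also have "\<dots> = t powr (- s)"
        using 2 powr_mult_base[of t "- s - 1"] by simp
      finally have "ennreal ((1 - exp (- t)) * t powr (- s - 1)) \<le> ennreal (t powr (- s))"
        by (rule ennreal_leI)
      then show ?thesis using 2 by (simp add: add_increasing2)
    next
      case 3
      have "(1 - exp (- t)) * t powr (- s - 1) \<le> 1 * t powr (- s - 1)"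
        by (intro mult_right_mono) auto
      then show ?thesis using 3 by (simp add: ennreal_leI)
    qed auto
  qed
  also have "\<dots> = (\<integral>\<^sup>+t. ennreal (indicator {0..1} t * t powr (- s)) \<partial>lborel) +
      (\<integral>\<^sup>+t. ennreal (indicator {1..} t * t powr (- s - 1)) \<partial>lborel)"
    by (rule nn_integral_add) measurable
  also have "(\<integral>\<^sup>+t. ennreal (indicator {0..1} t * t powr (- s)) \<partial>lborel) = ennreal (1 powr (- s + 1) / (- s + 1))"
    using s by (intro nn_integral_has_integral_lebesgue has_integral_powr_from_0) auto
  also have "(\<integral>\<^sup>+t. ennreal (indicator {1..} t * t powr (- s - 1)) \<partial>lborel) = ennreal (- (1 powr (- s - 1 + 1)) / (- s - 1 + 1))"
    using s by (intro nn_integral_has_integral_lebesgue has_integral_powr_to_inf) auto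
  finally have "?I \<noteq> \<infinity>"
    by (auto simp: top_unique simp flip: ennreal_plus)
  moreover have "?I \<noteq> 0"
  proof
    assume "?I = 0"
    then have "AE t in lborel. ennreal ((1 - exp (- t)) * t powr (- s - 1)) * indicator {0<..} t = 0"
      by (subst (asm) nn_integral_0_iff_AE) auto
    then have "AE t in lborel. \<not> (t \<in> {0<..<1::real})"
    proof eventually_elim
      case (elim t)
      show ?case
      proof
        assume t: "t \<in> {0<..<1}"
        then have "0 < (1 - exp (- t)) * t powr (- s - 1)"
          by (intro mult_pos_pos) auto
        then have "ennreal ((1 - exp (- t)) * t powr (- s - 1)) \<noteq> 0"
          by (simp only: ennreal_eq_0_iff not_le not_False_eq_True)
        then show False using elim t by simp
      qed
    qed
    then have "{0<..<1::real} \<in> null_sets lborel"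
      by (subst (asm) AE_iff_null_sets[symmetric]) auto
    then show False by (simp add: null_sets_def)
  qed
  ultimately show ?thesis
    using that by (cases ?I) (auto simp: less_le)
qed

text \<open>This covers \<open>s = 1\<close>, where the Mellin integral diverges at 0. The functions
  \<open>n * (1 - exp (- x / n))\<close> tend to \<open>x\<close>, by the derivative of the
  exponential at 0, and never exceed it; Fatou's lemma gives one inequality and the bound the other.
  A supremum lets the comparison pass through term by term.\<close>

lemma first_moment_SUP:
  assumes [measurable]: "X \<in> borel_measurable P" and X: "\<And>y. 0 \<le> X y"
  shows "(\<integral>\<^sup>+y. ennreal (X y) \<partial>P) =
    (SUP n. ennreal (real (Suc n)) * (\<integral>\<^sup>+y. ennreal (1 - exp (- (1 / real (Suc n) * X y))) \<partial>P))"
proof (rule antisym)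
  let ?f = "\<lambda>n y. ennreal (real (Suc n)) * ennreal (1 - exp (- (1 / real (Suc n) * X y)))"
  have "(\<lambda>n. real (Suc n) * (1 - exp (- (1 / real (Suc n) * x)))) \<longlonglongrightarrow> x" for x :: real
  proof -
    have "((\<lambda>h. exp (- (h * x))) has_field_derivative - x) (at 0)"
      by (auto intro!: derivative_eq_intros)
    then have "((\<lambda>h. (exp (- (h * x)) - exp (- (0 * x))) / h) \<longlongrightarrow> - x) (at 0)"
      by (simp add: DERIV_def)
    moreover have "filterlim (\<lambda>n. 1 / real (Suc n)) (at 0) sequentially"
      using LIMSEQ_inverse_real_of_nat by (auto simp: filterlim_at inverse_eq_divide)
    ultimately have "(\<lambda>n. (exp (- (1 / real (Suc n) * x)) - exp (- (0 * x))) / (1 / real (Suc n))) \<longlonglongrightarrow> - x"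
      by (rule filterlim_compose)
    from tendsto_minus[OF this] show ?thesis
      by (simp add: algebra_simps)
  qed
  then have "(\<lambda>n. ?f n y) \<longlonglongrightarrow> ennreal (X y)" for y
    using X by (subst ennreal_mult[symmetric]) (auto intro: tendsto_ennrealI)
  then have "(\<integral>\<^sup>+y. ennreal (X y) \<partial>P) = (\<integral>\<^sup>+y. liminf (\<lambda>n. ?f n y) \<partial>P)"
    by (intro nn_integral_cong) (metis lim_imp_Liminf trivial_limit_sequentially)
  also have "\<dots> \<le> liminf (\<lambda>n. \<integral>\<^sup>+y. ?f n y \<partial>P)"
    by (rule nn_integral_liminf) measurable
  also have "\<dots> \<le> (SUP n. \<integral>\<^sup>+y. ?f n y \<partial>P)"
    unfolding liminf_SUP_INF by (intro SUP_mono) (blast intro: INF_lower)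
  finally show "(\<integral>\<^sup>+y. ennreal (X y) \<partial>P) \<le>
      (SUP n. ennreal (real (Suc n)) * (\<integral>\<^sup>+y. ennreal (1 - exp (- (1 / real (Suc n) * X y))) \<partial>P))"
    by (subst (asm) nn_integral_cmult) auto
  have "?f n y \<le> ennreal (X y)" for n y
  proof -
    have "real (Suc n) * (1 - exp (- (1 / real (Suc n) * X y))) \<le> real (Suc n) * (1 / real (Suc n) * X y)"
      using exp_ge_add_one_self[of "- (1 / real (Suc n) * X y)"] by (intro mult_left_mono) auto
    then show ?thesis
      using X[of y] by (subst ennreal_mult[symmetric]) (auto intro!: ennreal_leI)
  qed
  then have "(\<integral>\<^sup>+y. ?f n y \<partial>P) \<le> (\<integral>\<^sup>+y. ennreal (X y) \<partial>P)" for n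
    by (intro nn_integral_mono) auto
  then show "(SUP n. ennreal (real (Suc n)) * (\<integral>\<^sup>+y. ennreal (1 - exp (- (1 / real (Suc n) * X y))) \<partial>P)) \<le> (\<integral>\<^sup>+y. ennreal (X y) \<partial>P)"
    by (intro SUP_least) (subst nn_integral_cmult[symmetric], auto)
qed

text \<open>Negative powers are mixtures of \<open>exp (- t * x)\<close> and keep the direction of
  the Laplace comparison. Powers of order \<open>s < 1\<close> are mixtures of
  \<open>1 - exp (- t * x)\<close>, and \<open>s = 1\<close> is a limit of such functions, so there
  the direction is reversed.\<close>

lemma moment_comparison:
  assumes "prob_space P" and [measurable]: "X \<in> borel_measurable P" "Y \<in> borel_measurable P"
    and nn: "\<And>y. 0 \<le> X y" "\<And>y. 0 \<le> Y y"
    and pos: "AE y in P. 0 < X y" "AE y in P. 0 < Y y"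
    and le: "\<And>t. 0 < t \<Longrightarrow> (\<integral>\<^sup>+y. ennreal (exp (- t * X y)) \<partial>P) \<le> (\<integral>\<^sup>+y. ennreal (exp (- t * Y y)) \<partial>P)"
  shows "0 < r \<Longrightarrow> (\<integral>\<^sup>+y. ennreal (X y powr (- r)) \<partial>P) \<le> (\<integral>\<^sup>+y. ennreal (Y y powr (- r)) \<partial>P)"
    and "0 < s \<Longrightarrow> s \<le> 1 \<Longrightarrow> (\<integral>\<^sup>+y. ennreal (Y y powr s) \<partial>P) \<le> (\<integral>\<^sup>+y. ennreal (X y powr s) \<partial>P)"
proof -
  interpret prob_space P by fact
  show "(\<integral>\<^sup>+y. ennreal (X y powr (- r)) \<partial>P) \<le> (\<integral>\<^sup>+y. ennreal (Y y powr (- r)) \<partial>P)" if r: "0 < r"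
  proof -
    obtain C where "(\<integral>\<^sup>+t. ennreal (exp (- t) * t powr (r - 1)) * indicator {0<..} t \<partial>lborel) = ennreal C" "0 < C"
      using Mellin_constant_exp[OF r] .
    then show ?thesis
      by (intro Mellin_comparison[where h="\<lambda>t. exp (- t)"] pos) (use le in \<open>auto intro: sigma_finite_measure_axioms\<close>)
  qed
  \<comment> \<open>The total mass is 1, so the integral of \<open>1 - exp (- (t * Z y))\<close> is
    1 minus the Laplace transform; subtraction reverses the inequality.\<close>
  have compl: "(\<integral>\<^sup>+y. ennreal (1 - exp (- (t * Y y))) \<partial>P) \<le> (\<integral>\<^sup>+y. ennreal (1 - exp (- (t * X y))) \<partial>P)" if t: "0 < t" for t
  proof -
    have eq: "(\<integral>\<^sup>+y. ennreal (1 - exp (- (t * Z y))) \<partial>P) = 1 - (\<integral>\<^sup>+y. ennreal (exp (- t * Z y)) \<partial>P)"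
      if [measurable]: "Z \<in> borel_measurable P" and Z: "\<And>y. 0 \<le> Z y" for Z
    proof -
      have Z': "exp (- t * Z y) \<le> 1" for y using Z[of y] t by simp
      have "(\<integral>\<^sup>+y. ennreal (exp (- t * Z y)) \<partial>P) \<le> (\<integral>\<^sup>+y. 1 \<partial>P)"
        using Z' by (intro nn_integral_mono) (simp add: ennreal_le_1)
      then have "(\<integral>\<^sup>+y. ennreal (exp (- t * Z y)) \<partial>P) \<noteq> \<infinity>"
        by (auto simp: emeasure_space_1 top_unique)
      then have "(\<integral>\<^sup>+y. 1 - ennreal (exp (- t * Z y)) \<partial>P) = (\<integral>\<^sup>+y. 1 \<partial>P) - (\<integral>\<^sup>+y. ennreal (exp (- t * Z y)) \<partial>P)"
        using Z' by (intro nn_integral_diff) (auto simp: ennreal_le_1)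
      moreover have "ennreal (1 - exp (- (t * Z y))) = 1 - ennreal (exp (- t * Z y))" for y
        using ennreal_minus[of "exp (- t * Z y)" 1] by simp
      ultimately show ?thesis by (simp add: emeasure_space_1)
    qed
    show ?thesis
      unfolding eq[OF assms(2) nn(1)] eq[OF assms(3) nn(2)] using le[OF t] by (rule ennreal_minus_mono[OF order_refl])
  qed
  show "(\<integral>\<^sup>+y. ennreal (Y y powr s) \<partial>P) \<le> (\<integral>\<^sup>+y. ennreal (X y powr s) \<partial>P)" if s: "0 < s" "s \<le> 1"
  proof (cases "s = 1")
    case True
    have "(\<integral>\<^sup>+y. ennreal (Y y) \<partial>P) \<le> (\<integral>\<^sup>+y. ennreal (X y) \<partial>P)"
      unfolding first_moment_SUP[OF assms(2) nn(1)] first_moment_SUP[OF assms(3) nn(2)]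
      by (intro SUP_mono' mult_left_mono compl) auto
    then show ?thesis using True nn by simp
  next
    case False
    with s have s: "0 < s" "s < 1" by auto
    obtain C where "(\<integral>\<^sup>+t. ennreal ((1 - exp (- t)) * t powr (- s - 1)) * indicator {0<..} t \<partial>lborel) = ennreal C" "0 < C"
      using Mellin_constant_one_minus_exp[OF s] .
    then have "(\<integral>\<^sup>+y. ennreal (Y y powr (- (- s))) \<partial>P) \<le> (\<integral>\<^sup>+y. ennreal (X y powr (- (- s))) \<partial>P)"
      by (intro Mellin_comparison[where h="\<lambda>t. 1 - exp (- t)"] pos compl) (auto intro: sigma_finite_measure_axioms)
    then show ?thesis by simp
  qed
qed

section \<open>Coordinates of a Gaussian vector on a subspace\<close>

lemma prob_space_std_gauss: "prob_space (std_gauss :: 'a::euclidean_space measure)"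
proof
  have "emeasure (std_gauss :: 'a measure) UNIV = (\<integral>\<^sup>+y. (\<Prod>b\<in>Basis. ennreal (std_normal_density ((y::'a) \<bullet> b))) \<partial>lborel)"
    by (simp add: std_gauss_def emeasure_density prod_ennreal)
  also have "\<dots> = 1"
    by (subst nn_integral_lborel_prod) (auto simp: nn_integral_std_normal_density)
  finally show "emeasure (std_gauss :: 'a measure) (space std_gauss) = 1" by simp
qed

text \<open>The power sum vanishes only if every \<open>y \<bullet> v i\<close> does, and then
  \<open>norm y = 0\<close> by hypothesis; a single point is a null set.\<close>

lemma AE_power_sum_pos:
  fixes v :: "'n::finite \<Rightarrow> 'a::euclidean_space"
  assumes "\<And>y. (\<Sum>i\<in>UNIV. (y \<bullet> v i)\<^sup>2) = (norm y)\<^sup>2"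
  shows "AE y in std_gauss. 0 < power_sum p v y"
proof -
  have "0 < power_sum p v y" if "y \<noteq> 0" for y
  proof -
    have "\<exists>i. y \<bullet> v i \<noteq> 0"
    proof (rule ccontr)
      assume "\<not> ?thesis"
      then show False using assms[of y] that by simp
    qed
    then obtain i where "y \<bullet> v i \<noteq> 0" ..
    then show ?thesis
      unfolding power_sum_def by (intro sum_pos2[of _ i]) auto
  qed
  moreover have "AE y in lborel. y \<noteq> (0 :: 'a)"
    by (rule AE_lborel_singleton)
  ultimately have "AE y in lborel. 0 < power_sum p v y" by auto
  then show ?thesis
    unfolding std_gauss_def by (subst AE_density) auto
qed

text \<open>Independence makes the joint law of the coordinates a product of normal laws, which has
  the product density with respect to Lebesgue measure on the coordinate space; both identities are
  checked on boxes. Assembling the coordinates into a vector carries this law to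
  \<open>std_gauss\<close>. The bijection \<open>\<sigma>\<close> is there because independence is
  indexed by \<open>B\<close> while the target space has its own \<open>Basis\<close>.\<close>

lemma distr_coordinates_std_gauss:
  fixes M :: "'w measure" and X :: "'a::euclidean_space \<Rightarrow> 'w \<Rightarrow> real"
  assumes "prob_space M" "finite B" "B \<noteq> {}" and \<sigma>: "bij_betw \<sigma> (Basis :: 'a set) B"
    and indep: "prob_space.indep_vars M (\<lambda>_. borel) Z B"
    and dist: "\<And>b. b \<in> B \<Longrightarrow> distributed M lborel (Z b) std_normal_density"
  shows "distr M borel (\<lambda>w. \<Sum>c\<in>Basis. Z (\<sigma> c) w *\<^sub>R c) = std_gauss"
proof -
  interpret prob_space M by fact
  interpret product_sigma_finite "\<lambda>_::'a. density lborel (\<lambda>x. ennreal (std_normal_density x))"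
    by (intro product_sigma_finite.intro prob_space_imp_sigma_finite prob_space_normal_density) simp
  interpret lb: product_sigma_finite "\<lambda>_::'a. lborel :: real measure" by standard
  let ?N = "density lborel (\<lambda>x. ennreal (std_normal_density x))"
  let ?P = "PiM (Basis :: 'a set) (\<lambda>_. lborel :: real measure)"
  let ?T = "\<lambda>f. \<Sum>c\<in>(Basis :: 'a set). f c *\<^sub>R c"
  let ?\<phi> = "\<lambda>f. ennreal (\<Prod>c\<in>(Basis :: 'a set). std_normal_density (f c))"
  have \<sigma>B: "\<sigma> c \<in> B" if "c \<in> Basis" for c using \<sigma> that by (auto simp: bij_betw_def)
  have Z[measurable]: "Z b \<in> borel_measurable M" if "b \<in> B" for b
    using dist[OF that] by (simp add: distributed_def)
  have Z\<sigma>[measurable]: "Z (\<sigma> c) \<in> borel_measurable M" if "c \<in> Basis" for c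
    using Z \<sigma>B[OF that] by simp
  have em: "emeasure M (Z b -` A \<inter> space M) = emeasure ?N A" if "b \<in> B" "A \<in> sets borel" for b A
  proof -
    have "distr M lborel (Z b) = ?N" using dist[OF that(1)] by (simp add: distributed_def)
    then have "emeasure ?N A = emeasure (distr M lborel (Z b)) A" by simp
    also have "\<dots> = emeasure M (Z b -` A \<inter> space M)"
      using that by (intro emeasure_distr) auto
    finally show ?thesis ..
  qed
  have R[measurable]: "(\<lambda>w. \<lambda>c\<in>Basis. Z (\<sigma> c) w) \<in> M \<rightarrow>\<^sub>M ?P"
    by (intro measurable_restrict) simp
  have 1: "distr M ?P (\<lambda>w. \<lambda>c\<in>Basis. Z (\<sigma> c) w) = PiM Basis (\<lambda>_. ?N)"
  proof (rule PiM_eqI)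
    show "sets (distr M ?P (\<lambda>w. \<lambda>c\<in>Basis. Z (\<sigma> c) w)) = sets (PiM Basis (\<lambda>_. ?N))"
      by (simp cong: sets_PiM_cong)
    fix A :: "'a \<Rightarrow> real set" assume A: "\<And>c. c \<in> Basis \<Longrightarrow> A c \<in> sets ?N"
    \<comment> \<open>The inverse of \<open>\<sigma>\<close>, used to turn a box indexed by
      \<open>Basis\<close> into events indexed by \<open>B\<close>, where independence is
      available.\<close>
    define \<rho> where "\<rho> = inv_into Basis \<sigma>"
    have \<rho>: "\<rho> (\<sigma> c) = c" if "c \<in> Basis" for c
      using \<sigma> that by (simp add: \<rho>_def bij_betw_def)
    have \<rho>B: "\<rho> b \<in> Basis" if "b \<in> B" for b
      using \<sigma> that by (auto simp: \<rho>_def bij_betw_def intro: inv_into_into)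
    have "emeasure (distr M ?P (\<lambda>w. \<lambda>c\<in>Basis. Z (\<sigma> c) w)) (PiE Basis A) =
      emeasure M ((\<lambda>w. \<lambda>c\<in>Basis. Z (\<sigma> c) w) -` PiE Basis A \<inter> space M)"
      using A by (intro emeasure_distr R sets_PiM_I_finite) auto
    also have "(\<lambda>w. \<lambda>c\<in>Basis. Z (\<sigma> c) w) -` PiE Basis A \<inter> space M = (\<Inter>b\<in>B. Z b -` A (\<rho> b) \<inter> space M)"
    proof -
      have "B = \<sigma> ` Basis" using \<sigma> by (simp add: bij_betw_def)
      then show ?thesis using \<rho> \<open>B \<noteq> {}\<close> by (auto simp: PiE_iff)
    qed
    also have "emeasure M \<dots> = ennreal (\<Prod>b\<in>B. prob (Z b -` A (\<rho> b) \<inter> space M))"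
      using A \<rho>B \<open>finite B\<close> \<open>B \<noteq> {}\<close> by (subst emeasure_eq_measure, subst indep_varsD_finite[OF indep]) auto
    also have "\<dots> = (\<Prod>b\<in>B. emeasure M (Z b -` A (\<rho> b) \<inter> space M))"
      by (simp add: emeasure_eq_measure prod_ennreal)
    also have "\<dots> = (\<Prod>b\<in>B. emeasure ?N (A (\<rho> b)))"
      using A \<rho>B by (intro prod.cong em) auto
    also have "\<dots> = (\<Prod>c\<in>Basis. emeasure ?N (A c))"
      using prod.reindex_bij_betw[OF \<sigma>, of "\<lambda>b. emeasure ?N (A (\<rho> b))"] by (simp add: \<rho>)
    finally show "emeasure (distr M ?P (\<lambda>w. \<lambda>c\<in>Basis. Z (\<sigma> c) w)) (PiE Basis A) = (\<Prod>c\<in>Basis. emeasure ?N (A c))" .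
  qed simp
  have 2: "density ?P ?\<phi> = PiM Basis (\<lambda>_. ?N)"
  proof (rule PiM_eqI)
    show "sets (density ?P ?\<phi>) = sets (PiM Basis (\<lambda>_. ?N))"
      by (simp cong: sets_PiM_cong)
    fix A :: "'a \<Rightarrow> real set" assume A: "\<And>c. c \<in> Basis \<Longrightarrow> A c \<in> sets ?N"
    have "emeasure (density ?P ?\<phi>) (PiE Basis A) = (\<integral>\<^sup>+f. ?\<phi> f * indicator (PiE Basis A) f \<partial>?P)"
      using A by (intro emeasure_density sets_PiM_I_finite) auto
    also have "\<dots> = (\<integral>\<^sup>+f. (\<Prod>c\<in>Basis. ennreal (std_normal_density (f c)) * indicator (A c) (f c)) \<partial>?P)"
    proof (rule nn_integral_cong)
      fix f assume f: "f \<in> space ?P"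
      have "(\<Prod>c\<in>Basis. indicator (A c) (f c) :: ennreal) = indicator (PiE Basis A) f"
      proof (cases "f \<in> PiE Basis A")
        case False
        then obtain c where "c \<in> Basis" "f c \<notin> A c"
          using f by (auto simp: space_PiM PiE_iff)
        then show ?thesis using False by (auto intro!: prod_zero bexI[of _ c])
      qed (auto simp: PiE_iff)
      then show "?\<phi> f * indicator (PiE Basis A) f = (\<Prod>c\<in>Basis. ennreal (std_normal_density (f c)) * indicator (A c) (f c))"
        by (simp add: prod.distrib prod_ennreal)
    qed
    also have "\<dots> = (\<Prod>c\<in>Basis. \<integral>\<^sup>+x. ennreal (std_normal_density x) * indicator (A c) x \<partial>lborel)"
      using A by (intro lb.product_nn_integral_prod) auto
    also have "\<dots> = (\<Prod>c\<in>Basis. emeasure ?N (A c))"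
      using A by (intro prod.cong) (auto simp: emeasure_density)
    finally show "emeasure (density ?P ?\<phi>) (PiE Basis A) = (\<Prod>c\<in>Basis. emeasure ?N (A c))" .
  qed simp
  have [measurable]: "?T \<in> ?P \<rightarrow>\<^sub>M borel" by measurable
  have "distr M borel (\<lambda>w. \<Sum>c\<in>Basis. Z (\<sigma> c) w *\<^sub>R c) = distr (distr M ?P (\<lambda>w. \<lambda>c\<in>Basis. Z (\<sigma> c) w)) borel ?T"
    by (subst distr_distr) (auto simp: comp_def intro!: distr_cong)
  also have "\<dots> = distr (density ?P ?\<phi>) borel ?T"
    unfolding 1 2 ..
  also have "\<dots> = std_gauss"
  proof (rule measure_eqI)
    fix A assume "A \<in> sets (distr (density ?P ?\<phi>) borel ?T)"
    then have [measurable]: "A \<in> sets borel" by simp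
    have "emeasure (std_gauss :: 'a measure) A = (\<integral>\<^sup>+y. ennreal (\<Prod>b\<in>Basis. std_normal_density (y \<bullet> b)) * indicator A y \<partial>lborel)"
      by (simp add: std_gauss_def emeasure_density)
    also have "\<dots> = (\<integral>\<^sup>+f. ennreal (\<Prod>b\<in>Basis. std_normal_density (?T f \<bullet> b)) * indicator A (?T f) \<partial>?P)"
      by (subst lborel_eq, subst nn_integral_distr) auto
    also have "\<dots> = (\<integral>\<^sup>+f. ?\<phi> f * indicator (?T -` A \<inter> space ?P) f \<partial>?P)"
      by (intro nn_integral_cong) (auto split: split_indicator)
    also have "\<dots> = emeasure (density ?P ?\<phi>) (?T -` A \<inter> space ?P)"
      by (subst emeasure_density) auto
    also have "\<dots> = emeasure (distr (density ?P ?\<phi>) borel ?T) A"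
      by (subst emeasure_distr) auto
    finally show "emeasure (distr (density ?P ?\<phi>) borel ?T) A = emeasure (std_gauss :: 'a measure) A" ..
  qed simp
  finally show ?thesis .
qed

text \<open>The basis vectors of \<open>E\<close> are the columns of a matrix \<open>T\<close>, an
  isometry onto \<open>E\<close>, and the \<open>v i\<close> are its rows. The isometry property is
  the sum-of-squares identity; if \<open>E\<close> is the whole space, \<open>T\<close> is
  orthogonal and so its rows are orthonormal. Almost surely \<open>G = T Y\<close> with
  \<open>Y\<close> of law \<open>std_gauss\<close>.\<close>

lemma std_gaussian_on_rows:
  fixes E :: "(real ^ 'n) set" and G :: "'w \<Rightarrow> real ^ 'n"
  assumes "dim E = CARD('k::finite)" and G: "std_gaussian_on E M G"
  obtains v :: "'n \<Rightarrow> real ^ 'k" where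
    "\<And>y. (\<Sum>i\<in>UNIV. (y \<bullet> v i)\<^sup>2) = (norm y)\<^sup>2"
    "E = UNIV \<Longrightarrow> (\<And>i j. v i \<bullet> v j = (if i = j then 1 else 0))"
    "\<And>p r. lp_moment p M G r = (\<integral>\<^sup>+y. ennreal (power_sum p v y powr (r / p)) \<partial>std_gauss)"
proof -
  interpret prob_space M using G by (simp add: std_gaussian_on_def)
  obtain B where B: "orthonormal_basis_of E B" and indep: "indep_vars (\<lambda>_. borel) (\<lambda>b w. G w \<bullet> b) B"
    and dist: "\<And>b. b \<in> B \<Longrightarrow> distributed M lborel (\<lambda>w. G w \<bullet> b) std_normal_density"
    and [measurable]: "G \<in> borel_measurable M" and GE: "AE w in M. G w \<in> E"
    using G by (auto simp: std_gaussian_on_def)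
  have orth: "pairwise orthogonal B" and norm1: "\<And>b. b \<in> B \<Longrightarrow> norm b = 1" and span: "span B = E"
    using B by (auto simp: orthonormal_basis_of_def)
  have "0 \<notin> B" using norm1 by force
  then have "independent B" using orth by (rule pairwise_orthogonal_independent[rotated])
  then have card: "card B = CARD('k)" using dim_span_eq_card_independent[of B] span assms(1) by simp
  have fin: "finite B" using orth by (rule pairwise_orthogonal_imp_finite)
  have ne: "B \<noteq> {}" using card by auto
  have inner: "a \<bullet> b = (if a = b then 1 else 0)" if "a \<in> B" "b \<in> B" for a b
    using orth norm1 that by (auto simp: pairwise_def orthogonal_def norm_eq_1)
  obtain \<sigma> where \<sigma>: "bij_betw \<sigma> (Basis :: (real ^ 'k) set) B"
    using finite_same_card_bij[of "Basis :: (real ^ 'k) set" B] fin card by auto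
  have \<sigma>_inner: "\<sigma> c \<bullet> \<sigma> d = (if c = d then 1 else 0)" if "c \<in> Basis" "d \<in> Basis" for c d
    using \<sigma> that inner[of "\<sigma> c" "\<sigma> d"] by (auto simp: bij_betw_def inj_on_def)
  define T where "T y = (\<Sum>c\<in>Basis. (y \<bullet> c) *\<^sub>R \<sigma> c)" for y :: "real ^ 'k"
  define v :: "'n \<Rightarrow> real ^ 'k" where "v i = (\<Sum>c\<in>Basis. (\<sigma> c $ i) *\<^sub>R c)" for i
  have vT: "y \<bullet> v i = T y $ i" for y i
    by (simp add: v_def T_def inner_sum_right mult.commute)
  have "(\<Sum>i\<in>UNIV. (y \<bullet> v i)\<^sup>2) = (norm y)\<^sup>2" for y
  proof -
    have "(\<Sum>i\<in>UNIV. (y \<bullet> v i)\<^sup>2) = T y \<bullet> T y"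
      unfolding vT by (simp add: inner_vec_def power2_eq_square)
    also have "\<dots> = (\<Sum>c\<in>Basis. \<Sum>d\<in>Basis. (y \<bullet> c) * ((y \<bullet> d) * (\<sigma> c \<bullet> \<sigma> d)))"
      by (simp add: T_def inner_sum_left inner_sum_right sum_distrib_left inner_commute mult.left_commute)
    also have "\<dots> = (\<Sum>c\<in>Basis. \<Sum>d\<in>Basis. if c = d then (y \<bullet> c) * (y \<bullet> d) else 0)"
      by (intro sum.cong refl) (simp add: \<sigma>_inner)
    also have "\<dots> = y \<bullet> y"
      by (subst euclidean_inner) simp
    finally show ?thesis by (simp add: power2_norm_eq_inner)
  qed
  moreover have "v i \<bullet> v j = (if i = j then 1 else 0)" if "E = UNIV" for i j
  proof -
    \<comment> \<open>\<open>T (v i)\<close> is the expansion of the \<open>i\<close>-th unit vector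
      in the basis \<open>B\<close>, which returns that vector because \<open>B\<close> spans the
      whole space; its \<open>j\<close>-th coordinate is \<open>v i \<bullet> v j\<close>.\<close>
    have "T (v i) = (\<Sum>c\<in>Basis. (axis i 1 \<bullet> \<sigma> c) *\<^sub>R \<sigma> c)"
      unfolding T_def v_def by (intro sum.cong) (auto simp: inner_axis' inner_sum_left_Basis)
    also have "\<dots> = (\<Sum>b\<in>B. (axis i 1 \<bullet> b) *\<^sub>R b)"
      by (rule sum.reindex_bij_betw[OF \<sigma>])
    also have "\<dots> = axis i 1"
      using orth norm1 fin span that by (intro orthonormal_basis_expand) auto
    finally show ?thesis unfolding vT by (auto simp: axis_def)
  qed
  moreover have "lp_moment p M G r = (\<integral>\<^sup>+y. ennreal (power_sum p v y powr (r / p)) \<partial>std_gauss)" for p r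
  proof -
    let ?Y = "\<lambda>w. \<Sum>c\<in>Basis. (G w \<bullet> \<sigma> c) *\<^sub>R (c :: real ^ 'k)"
    have law: "distr M borel ?Y = std_gauss"
      by (rule distr_coordinates_std_gauss[OF prob_space_axioms fin ne \<sigma> indep dist])
    have norm: "lp_norm p (T y) powr r = power_sum p v y powr (r / p)" for y
      by (simp add: lp_norm_def power_sum_def vT powr_powr)
    \<comment> \<open>Membership of \<open>G w\<close> in \<open>E\<close> holds only almost surely;
      where it holds, the expansion in \<open>B\<close> recovers \<open>G w\<close> from its
      coordinates.\<close>
    have "lp_moment p M G r = (\<integral>\<^sup>+w. ennreal (lp_norm p (T (?Y w)) powr r) \<partial>M)"
      unfolding lp_moment_def
    proof (rule nn_integral_cong_AE, use GE in eventually_elim)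
      case (elim w)
      have "T (?Y w) = (\<Sum>c\<in>Basis. (G w \<bullet> \<sigma> c) *\<^sub>R \<sigma> c)"
        unfolding T_def by (intro sum.cong) (auto simp: inner_sum_left_Basis)
      also have "\<dots> = (\<Sum>b\<in>B. (G w \<bullet> b) *\<^sub>R b)"
        by (rule sum.reindex_bij_betw[OF \<sigma>])
      also have "\<dots> = G w"
        using orth norm1 fin span elim by (intro orthonormal_basis_expand) auto
      finally show ?case by simp
    qed
    also have "\<dots> = (\<integral>\<^sup>+y. ennreal (power_sum p v y powr (r / p)) \<partial>distr M borel ?Y)"
      unfolding norm by (subst nn_integral_distr) auto
    finally show ?thesis unfolding law .
  qed
  ultimately show ?thesis by (rule that)
qed

section \<open>Both ranges of \<open>p\<close>, obtained from the Laplace comparison for the rows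
  belonging to \<open>E\<close> and to the whole space\<close>

theorem corollary19:
  fixes E :: "(real ^ 'n) set"
    and M :: "'w measure" and G :: "'w \<Rightarrow> real ^ 'n"
    and N :: "'v measure" and H :: "'v \<Rightarrow> real ^ 'k"
    and p :: real
  assumes "subspace E"
    and "dim E = CARD('k)"
    and "std_gaussian_on E M G"
    and "std_gaussian_on UNIV N H"
  shows "(0 < p \<and> p < 2 \<longrightarrow>
           (\<forall>\<alpha> \<beta>. 0 < \<alpha> \<and> \<alpha> < real CARD('k) \<and> 0 < \<beta> \<and> \<beta> \<le> p \<longrightarrow>
              lp_moment p M G (- \<alpha>) \<le> lp_moment p N H (- \<alpha>) \<and>
              lp_moment p M G \<beta> \<ge> lp_moment p N H \<beta>)) \<and>
         (2 < p \<longrightarrow>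
           (\<forall>\<alpha> \<beta>. 0 < \<alpha> \<and> \<alpha> < real CARD('k) \<and> 0 < \<beta> \<and> \<beta> \<le> p \<longrightarrow>
              lp_moment p M G (- \<alpha>) \<ge> lp_moment p N H (- \<alpha>) \<and>
              lp_moment p M G \<beta> \<le> lp_moment p N H \<beta>))"
proof -
  obtain v :: "'n \<Rightarrow> real ^ 'k" where v: "\<And>y. (\<Sum>i\<in>UNIV. (y \<bullet> v i)\<^sup>2) = (norm y)\<^sup>2"
    and Gm: "\<And>p r. lp_moment p M G r = (\<integral>\<^sup>+y. ennreal (power_sum p v y powr (r / p)) \<partial>std_gauss)"
    using std_gaussian_on_rows[OF assms(2,3)] by metis
  have "dim (UNIV :: (real ^ 'k) set) = CARD('k)" by simp
  then obtain w :: "'k \<Rightarrow> real ^ 'k" where w: "\<And>y. (\<Sum>i\<in>UNIV. (y \<bullet> w i)\<^sup>2) = (norm y)\<^sup>2"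
    and ww: "\<And>i j. w i \<bullet> w j = (if i = j then 1 else 0)"
    and Hm: "\<And>p r. lp_moment p N H r = (\<integral>\<^sup>+y. ennreal (power_sum p w y powr (r / p)) \<partial>std_gauss)"
    using std_gaussian_on_rows[OF _ assms(4)] by metis
  have orth: "\<And>i j. i \<noteq> j \<Longrightarrow> w i \<bullet> w j = 0" "\<And>i. w i \<noteq> 0"
    using ww by (auto, metis inner_zero_left zero_neq_one)
  note L = Laplace_comparison[OF v w orth]
  note moment = moment_comparison[OF prob_space_std_gauss _ _ power_sum_nonneg power_sum_nonneg]
  note pos = AE_power_sum_pos[OF v] AE_power_sum_pos[OF w]
  \<comment> \<open>Moments of the norm of order \<open>- \<alpha>\<close> and
    \<open>\<beta>\<close> are moments of the power sum of order \<open>- \<alpha> / p\<close> and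
    \<open>\<beta> / p\<close>; the latter is at most 1 exactly because
    \<open>\<beta> \<le> p\<close>. For \<open>p > 2\<close> the two power sums trade
    places.\<close>
  show ?thesis
  proof (intro conjI impI allI; elim conjE)
    fix \<alpha> \<beta> :: real assume p: "0 < p" "p < 2" and ab: "0 < \<alpha>" "0 < \<beta>" "\<beta> \<le> p"
    show "lp_moment p M G (- \<alpha>) \<le> lp_moment p N H (- \<alpha>)"
      using moment(1)[OF _ _ pos L(2), of p "\<alpha> / p"] p ab by (simp add: Gm Hm)
    show "lp_moment p M G \<beta> \<ge> lp_moment p N H \<beta>"
      using moment(2)[OF _ _ pos L(2), of p "\<beta> / p"] p ab by (simp add: Gm Hm)
  next
    fix \<alpha> \<beta> :: real assume p: "2 < p" and ab: "0 < \<alpha>" "0 < \<beta>" "\<beta> \<le> p"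
    show "lp_moment p M G (- \<alpha>) \<ge> lp_moment p N H (- \<alpha>)"
      using moment(1)[OF _ _ pos(2,1) L(1), of p "\<alpha> / p"] p ab by (simp add: Gm Hm)
    show "lp_moment p M G \<beta> \<le> lp_moment p N H \<beta>"
      using moment(2)[OF _ _ pos(2,1) L(1), of p "\<beta> / p"] p ab by (simp add: Gm Hm)
  qed
qed

end
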